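(* Let $f\colon(\mathbb{R}^2,0)\to(\mathbb{R}^3,0)$ be a frontal and $0$ a pure-frontal singular point of $f$, with $\kappa_t(0)\ne0$ and principal curvatures nowhere zero. Let $j\in\{1,2\}$. Suppose that the secondary cuspidal curvature $r_c$ vanishes identically along the singular curve $\gamma$ of $f$ through $0$, and that $0$ is a first order $\boldsymbol{V}_j$-ridge point of $f$. Then $\gamma$ is also a singular curve for the focal surface $C_j$, consisting of pure-frontal singular points of $C_j$. In addition, the Gaussian curvature and the mean curvature of $C_j$ are bounded near $0$.
   Context: All maps are $C^\infty$. A map germ $f\colon(\mathbb{R}^2,0)\to\mathbb{R}^3$ is a frontal if there is a smooth $\nu\colon(\mathbb{R}^2,0)\to\mathbb{S}^2$ (a unit normal vector field) with $\langle df_q(X),\nu(q)\rangle=0$ for all $q$ and $X\in T_q\mathbb{R}^2$. Put $\lambda=\det(f_u,f_v,\nu)$ and $S(f)=\{q: \operatorname{rank}df_q<2\}=\lambda^{-1}(0)$. A singular point is non-degenerate if $d\lambda\ne0$ there; then near it $S(f)$ is a regular curve $\gamma$ (the singular curve) and there is a nowhere vanishing vector field $\eta$ (null vector field) with $df(\eta)=0$ along $\gamma$. It is of the first kind if $\gamma'$ and $\eta$ are linearly independent there. A singular point of the first kind is a pure-frontal singular point if $\psi(t)=\det((f\circ\gamma)'(t),\nu(\gamma(t)),d\nu_{\gamma(t)}(\eta))$ vanishes identically along $\gamma$. Adapted coordinates: around a pure-frontal singular point there are coordinates $(u,v)$ with $S(f)=\{v=0\}$, $\partial_v$ a null vector field,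 and $\{f_u,f_{vv},\nu\}$ orthonormal along the $u$-axis; fix such coordinates. Then $f_v=vh$, $\nu_v=v\nu_1$ with $h,\nu_1$ smooth. Put $\tilde E=\langle f_u,f_u\rangle$, $\tilde F=\langle f_u,h\rangle$, $\tilde G=\langle h,h\rangle$, $\tilde L=-\langle f_u,\nu_u\rangle$, $\tilde M=-\langle h,\nu_u\rangle$, $\tilde N_1=-\langle h,\nu_1\rangle$. The Gaussian and mean curvatures of $f$ extend smoothly as $K=\frac{\tilde L\tilde N_1-\tilde M^2}{\tilde E\tilde G-\tilde F^2}$, $H=\frac{\tilde E\tilde N_1-2\tilde F\tilde M+\tilde G\tilde L}{2(\tilde E\tilde G-\tilde F^2)}$, and the principal curvatures are $\kappa_1=H+\sqrt{H^2-K}$, $\kappa_2=H-\sqrt{H^2-K}$ (distinct and smooth near $0$ if $\kappa_t(0)\ne0$). Along the $u$-axis, the cuspidal torsion is $\kappa_t(u)=\tilde M(u,0)$ and the secondary cuspidal curvature is $r_c(u)=24\bigl((\tilde N_1)_v-2\tilde F_v\tilde M-\tilde G_v\tilde N_1\bigr)(u,0)$. Principal vectors: $\boldsymbol{V}_j=-v(\tilde M-\kappa_j\tilde F)\partial_u+(\tilde L-\kappa_j\tilde E)\partial_v$. The point $0$ is a first order $\boldsymbol{V}_j$-ridge point if $\boldsymbol{V}_j\kappa_j=0$ and $\boldsymbol{V}_j(\boldsymbol{V}_j\kappa_j)\ne0$ at $0$. The focal surface associated to $\kappa_j$ is $C_j=f+\rho_j\nu$, $\rho_j=1/\kappa_j$.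 When $\kappa_t(0)\ne0$ it is a frontal near $0$ with unit normal $\boldsymbol{e}_j=\boldsymbol{x}_j/|\boldsymbol{x}_j|$, where $\boldsymbol{x}_j=-(\tilde M-\kappa_j\tilde F)f_u+(\tilde L-\kappa_j\tilde E)h$; notions for singular points of $C_j$ are with respect to this structure. The Gaussian and mean curvatures of $C_j$ are those of its regular part; bounded near $0$ means bounded on the set of regular points of $C_j$ in some neighbourhood of $0$. *)

theory Defs
  imports "HOL-Analysis.Analysis"
begin

section \<open>Smooth maps\<close>

text \<open>Both predicates are meant for open \<open>S\<close>.\<close>

primrec Ck_on :: "nat \<Rightarrow> 'a::real_normed_vector set \<Rightarrow> ('a \<Rightarrow> 'b::real_normed_vector) \<Rightarrow> bool" where
  "Ck_on 0 S f \<longleftrightarrow> continuous_on S f"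
| "Ck_on (Suc k) S f \<longleftrightarrow>
     (\<forall>x\<in>S. f differentiable (at x)) \<and> (\<forall>X. Ck_on k S (\<lambda>x. frechet_derivative f (at x) X))"

definition smooth_on :: "'a::real_normed_vector set \<Rightarrow> ('a \<Rightarrow> 'b::real_normed_vector) \<Rightarrow> bool" where
  "smooth_on S f \<longleftrightarrow> (\<forall>k. Ck_on k S f)"

definition Du :: "(real^2 \<Rightarrow> 'b::real_normed_vector) \<Rightarrow> real^2 \<Rightarrow> 'b" where
  "Du f q = frechet_derivative f (at q) (axis 1 1)"

definition Dv :: "(real^2 \<Rightarrow> 'b::real_normed_vector) \<Rightarrow> real^2 \<Rightarrow> 'b" where
  "Dv f q = frechet_derivative f (at q) (axis 2 1)"

definition det3 :: "real^3 \<Rightarrow> real^3 \<Rightarrow> real^3 \<Rightarrow> real" where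
  "det3 a b c = det (vector [a, b, c] :: real^3^3)"


section \<open>Frontals and their singular points\<close>

text \<open>A germ at the origin is given by a representative on an open set \<open>U\<close>; values outside
  \<open>U\<close> are irrelevant. The unit normal field \<open>n\<close> is part of the data.\<close>

definition frontal_on :: "(real^2) set \<Rightarrow> (real^2 \<Rightarrow> real^3) \<Rightarrow> (real^2 \<Rightarrow> real^3) \<Rightarrow> bool" where
  "frontal_on U f n \<longleftrightarrow> open U \<and> smooth_on U f \<and> smooth_on U n \<and>
     (\<forall>q\<in>U. norm (n q) = 1 \<and> (\<forall>X. frechet_derivative f (at q) X \<bullet> n q = 0))"

definition sing_set :: "(real^2) set \<Rightarrow> (real^2 \<Rightarrow> real^3) \<Rightarrow> (real^2) set" where
  "sing_set U f = {q\<in>U. rank (jacobian f (at q)) < 2}"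

definition lam :: "(real^2 \<Rightarrow> real^3) \<Rightarrow> (real^2 \<Rightarrow> real^3) \<Rightarrow> real^2 \<Rightarrow> real" where
  "lam f n q = det3 (Du f q) (Dv f q) (n q)"

definition nondegenerate_point ::
    "(real^2) set \<Rightarrow> (real^2 \<Rightarrow> real^3) \<Rightarrow> (real^2 \<Rightarrow> real^3) \<Rightarrow> real^2 \<Rightarrow> bool" where
  "nondegenerate_point U f n p \<longleftrightarrow>
     p \<in> sing_set U f \<and> frechet_derivative (lam f n) (at p) \<noteq> (\<lambda>X. 0)"

definition singular_curve ::
    "(real^2) set \<Rightarrow> (real^2 \<Rightarrow> real^3) \<Rightarrow> real^2 \<Rightarrow> real \<Rightarrow> (real \<Rightarrow> real^2) \<Rightarrow> bool" where
  "singular_curve U f p \<epsilon> \<gamma> \<longleftrightarrow>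
     0 < \<epsilon> \<and> \<gamma> 0 = p \<and> smooth_on {-\<epsilon><..<\<epsilon>} \<gamma> \<and> inj_on \<gamma> {-\<epsilon><..<\<epsilon>} \<and>
     (\<forall>t\<in>{-\<epsilon><..<\<epsilon>}. vector_derivative \<gamma> (at t) \<noteq> 0) \<and>
     (\<exists>W. open W \<and> p \<in> W \<and> W \<subseteq> U \<and> \<gamma> ` {-\<epsilon><..<\<epsilon>} = sing_set U f \<inter> W)"

definition null_field ::
    "(real^2 \<Rightarrow> real^3) \<Rightarrow> (real^2) set \<Rightarrow> (real^2 \<Rightarrow> real^2) \<Rightarrow> bool" where
  "null_field f T \<eta> \<longleftrightarrow>
     (\<exists>N. open N \<and> T \<subseteq> N \<and> smooth_on N \<eta> \<and> (\<forall>q\<in>N. \<eta> q \<noteq> 0)) \<and>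
     (\<forall>q\<in>T. frechet_derivative f (at q) (\<eta> q) = 0)"

text \<open>The parametrised curve \<open>\<gamma>\<close> and the null field \<open>\<eta>\<close> witness that \<open>p\<close> is of the first kind.
  At a non-degenerate point the lines spanned by the derivative of \<open>\<gamma>\<close> and by \<open>\<eta>\<close> do not depend
  on the choice of \<open>\<gamma>\<close> and \<open>\<eta>\<close>.\<close>

definition first_kind_via ::
    "(real^2) set \<Rightarrow> (real^2 \<Rightarrow> real^3) \<Rightarrow> (real^2 \<Rightarrow> real^3) \<Rightarrow> real^2 \<Rightarrow>
     real \<Rightarrow> (real \<Rightarrow> real^2) \<Rightarrow> (real^2 \<Rightarrow> real^2) \<Rightarrow> bool" where
  "first_kind_via U f n p \<epsilon> \<gamma> \<eta> \<longleftrightarrow>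
     nondegenerate_point U f n p \<and> singular_curve U f p \<epsilon> \<gamma> \<and>
     null_field f (\<gamma> ` {-\<epsilon><..<\<epsilon>}) \<eta> \<and>
     (\<forall>a b. a *\<^sub>R vector_derivative \<gamma> (at 0) + b *\<^sub>R \<eta> p = 0 \<longrightarrow> a = 0 \<and> b = 0)"

definition psi ::
    "(real^2 \<Rightarrow> real^3) \<Rightarrow> (real^2 \<Rightarrow> real^3) \<Rightarrow> (real \<Rightarrow> real^2) \<Rightarrow> (real^2 \<Rightarrow> real^2) \<Rightarrow> real \<Rightarrow> real" where
  "psi f n \<gamma> \<eta> t =
     det3 (vector_derivative (f \<circ> \<gamma>) (at t)) (n (\<gamma> t)) (frechet_derivative n (at (\<gamma> t)) (\<eta> (\<gamma> t)))"

definition pure_frontal_point ::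
    "(real^2) set \<Rightarrow> (real^2 \<Rightarrow> real^3) \<Rightarrow> (real^2 \<Rightarrow> real^3) \<Rightarrow> real^2 \<Rightarrow> bool" where
  "pure_frontal_point U f n p \<longleftrightarrow>
     (\<exists>\<epsilon> \<gamma> \<eta>. first_kind_via U f n p \<epsilon> \<gamma> \<eta> \<and> (\<forall>t\<in>{-\<epsilon><..<\<epsilon>}. psi f n \<gamma> \<eta> t = 0))"


section \<open>Curvatures of the regular part\<close>

definition gauss_curvature :: "(real^2 \<Rightarrow> real^3) \<Rightarrow> (real^2 \<Rightarrow> real^3) \<Rightarrow> real^2 \<Rightarrow> real" where
  "gauss_curvature f n q =
    (let E = Du f q \<bullet> Du f q; F = Du f q \<bullet> Dv f q; G = Dv f q \<bullet> Dv f q;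
         L = - (Du f q \<bullet> Du n q); M = - (Dv f q \<bullet> Du n q); N = - (Dv f q \<bullet> Dv n q)
     in (L * N - M\<^sup>2) / (E * G - F\<^sup>2))"

definition mean_curvature :: "(real^2 \<Rightarrow> real^3) \<Rightarrow> (real^2 \<Rightarrow> real^3) \<Rightarrow> real^2 \<Rightarrow> real" where
  "mean_curvature f n q =
    (let E = Du f q \<bullet> Du f q; F = Du f q \<bullet> Dv f q; G = Dv f q \<bullet> Dv f q;
         L = - (Du f q \<bullet> Du n q); M = - (Dv f q \<bullet> Du n q); N = - (Dv f q \<bullet> Dv n q)
     in (E * N - 2 * F * M + G * L) / (2 * (E * G - F\<^sup>2)))"


section \<open>Adapted coordinates\<close>

definition coordinate_change ::
    "(real^2) set \<Rightarrow> (real^2) set \<Rightarrow> (real^2 \<Rightarrow> real^2) \<Rightarrow> (real^2 \<Rightarrow> real^2) \<Rightarrow> bool" where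
  "coordinate_change U V \<Phi> \<Psi> \<longleftrightarrow>
     open V \<and> 0 \<in> V \<and> \<Phi> 0 = 0 \<and> open (\<Phi> ` V) \<and> \<Phi> ` V \<subseteq> U \<and>
     smooth_on V \<Phi> \<and> smooth_on (\<Phi> ` V) \<Psi> \<and> (\<forall>q\<in>V. \<Psi> (\<Phi> q) = q)"

text \<open>Here \<open>g\<close> and \<open>m\<close> are the map and its unit normal written in the coordinates \<open>(u, v)\<close>.\<close>

definition adapted :: "(real^2) set \<Rightarrow> (real^2 \<Rightarrow> real^3) \<Rightarrow> (real^2 \<Rightarrow> real^3) \<Rightarrow> bool" where
  "adapted V g m \<longleftrightarrow>
     sing_set V g = {q\<in>V. q $ 2 = 0} \<and>
     (\<forall>q\<in>V. q $ 2 = 0 \<longrightarrow>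
        Dv g q = 0 \<and>
        norm (Du g q) = 1 \<and> norm (Dv (Dv g) q) = 1 \<and> norm (m q) = 1 \<and>
        Du g q \<bullet> Dv (Dv g) q = 0 \<and> Du g q \<bullet> m q = 0 \<and> Dv (Dv g) q \<bullet> m q = 0)"

text \<open>If \<open>Dv g\<close> vanishes on the \<open>u\<close>-axis, then \<open>Dv_over_v g\<close> is the smooth \<open>h\<close> with
  \<open>Dv g = v h\<close>; on the axis it takes the value forced by continuity.\<close>

definition Dv_over_v :: "(real^2 \<Rightarrow> real^3) \<Rightarrow> real^2 \<Rightarrow> real^3" where
  "Dv_over_v g q = (if q $ 2 = 0 then Dv (Dv g) q else Dv g q /\<^sub>R (q $ 2))"

definition Et :: "(real^2 \<Rightarrow> real^3) \<Rightarrow> real^2 \<Rightarrow> real" where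
  "Et g q = Du g q \<bullet> Du g q"
definition Ft :: "(real^2 \<Rightarrow> real^3) \<Rightarrow> real^2 \<Rightarrow> real" where
  "Ft g q = Du g q \<bullet> Dv_over_v g q"
definition Gt :: "(real^2 \<Rightarrow> real^3) \<Rightarrow> real^2 \<Rightarrow> real" where
  "Gt g q = Dv_over_v g q \<bullet> Dv_over_v g q"
definition Lt :: "(real^2 \<Rightarrow> real^3) \<Rightarrow> (real^2 \<Rightarrow> real^3) \<Rightarrow> real^2 \<Rightarrow> real" where
  "Lt g m q = - (Du g q \<bullet> Du m q)"
definition Mt :: "(real^2 \<Rightarrow> real^3) \<Rightarrow> (real^2 \<Rightarrow> real^3) \<Rightarrow> real^2 \<Rightarrow> real" where
  "Mt g m q = - (Dv_over_v g q \<bullet> Du m q)"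
definition N1t :: "(real^2 \<Rightarrow> real^3) \<Rightarrow> (real^2 \<Rightarrow> real^3) \<Rightarrow> real^2 \<Rightarrow> real" where
  "N1t g m q = - (Dv_over_v g q \<bullet> Dv_over_v m q)"

definition Kext :: "(real^2 \<Rightarrow> real^3) \<Rightarrow> (real^2 \<Rightarrow> real^3) \<Rightarrow> real^2 \<Rightarrow> real" where
  "Kext g m q = (Lt g m q * N1t g m q - (Mt g m q)\<^sup>2) / (Et g q * Gt g q - (Ft g q)\<^sup>2)"

definition Hext :: "(real^2 \<Rightarrow> real^3) \<Rightarrow> (real^2 \<Rightarrow> real^3) \<Rightarrow> real^2 \<Rightarrow> real" where
  "Hext g m q =
     (Et g q * N1t g m q - 2 * Ft g q * Mt g m q + Gt g q * Lt g m q) /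
     (2 * (Et g q * Gt g q - (Ft g q)\<^sup>2))"

definition principal_curvature ::
    "nat \<Rightarrow> (real^2 \<Rightarrow> real^3) \<Rightarrow> (real^2 \<Rightarrow> real^3) \<Rightarrow> real^2 \<Rightarrow> real" where
  "principal_curvature j g m q =
     (if j = 1 then Hext g m q + sqrt ((Hext g m q)\<^sup>2 - Kext g m q)
      else Hext g m q - sqrt ((Hext g m q)\<^sup>2 - Kext g m q))"

definition cuspidal_torsion :: "(real^2 \<Rightarrow> real^3) \<Rightarrow> (real^2 \<Rightarrow> real^3) \<Rightarrow> real \<Rightarrow> real" where
  "cuspidal_torsion g m u = Mt g m (vector [u, 0])"

definition secondary_cuspidal_curvature ::
    "(real^2 \<Rightarrow> real^3) \<Rightarrow> (real^2 \<Rightarrow> real^3) \<Rightarrow> real \<Rightarrow> real" where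
  "secondary_cuspidal_curvature g m u =
     (let q = vector [u, 0]
      in 24 * (Dv (N1t g m) q - 2 * Dv (Ft g) q * Mt g m q - Dv (Gt g) q * N1t g m q))"

definition principal_vector ::
    "nat \<Rightarrow> (real^2 \<Rightarrow> real^3) \<Rightarrow> (real^2 \<Rightarrow> real^3) \<Rightarrow> real^2 \<Rightarrow> real^2" where
  "principal_vector j g m q =
     vector [- (q $ 2) * (Mt g m q - principal_curvature j g m q * Ft g q),
             Lt g m q - principal_curvature j g m q * Et g q]"

definition along_field :: "(real^2 \<Rightarrow> real^2) \<Rightarrow> (real^2 \<Rightarrow> real) \<Rightarrow> real^2 \<Rightarrow> real" where
  "along_field X \<phi> q = frechet_derivative \<phi> (at q) (X q)"

definition first_order_ridge_point ::
    "nat \<Rightarrow> (real^2 \<Rightarrow> real^3) \<Rightarrow> (real^2 \<Rightarrow> real^3) \<Rightarrow> real^2 \<Rightarrow> bool" where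
  "first_order_ridge_point j g m p \<longleftrightarrow>
     (let X = principal_vector j g m; \<kappa> = principal_curvature j g m
      in along_field X \<kappa> p = 0 \<and> along_field X (along_field X \<kappa>) p \<noteq> 0)"

definition focal_surface ::
    "nat \<Rightarrow> (real^2 \<Rightarrow> real^3) \<Rightarrow> (real^2 \<Rightarrow> real^3) \<Rightarrow> real^2 \<Rightarrow> real^3" where
  "focal_surface j g m q = g q + (1 / principal_curvature j g m q) *\<^sub>R m q"

definition focal_direction ::
    "nat \<Rightarrow> (real^2 \<Rightarrow> real^3) \<Rightarrow> (real^2 \<Rightarrow> real^3) \<Rightarrow> real^2 \<Rightarrow> real^3" where
  "focal_direction j g m q =
     - (Mt g m q - principal_curvature j g m q * Ft g q) *\<^sub>R Du g q
     + (Lt g m q - principal_curvature j g m q * Et g q) *\<^sub>R Dv_over_v g q"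

definition focal_normal ::
    "nat \<Rightarrow> (real^2 \<Rightarrow> real^3) \<Rightarrow> (real^2 \<Rightarrow> real^3) \<Rightarrow> real^2 \<Rightarrow> real^3" where
  "focal_normal j g m q = focal_direction j g m q /\<^sub>R norm (focal_direction j g m q)"

end

theory Submission
  imports Defs
begin

text \<open>
Work in adapted coordinates \<open>(u, v)\<close>, where \<open>g = f \<circ> \<Phi>\<close> and \<open>m = \<nu> \<circ> \<Phi>\<close> have \<open>Dv g = v h\<close> and
\<open>Dv m = v l\<close>; the second factorisation is what it means for the axis to consist of pure-frontal
points (\<open>pure_frontal_imp_normal_derivative_zero\<close>). By Hadamard's lemma \<open>h\<close> and \<open>l\<close> are smooth
(\<open>smooth_on_Dv_over_v\<close>), so the extended fundamental forms and, thanks to the nonzero torsion, the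
principal curvature \<open>\<kappa>\<close> are smooth too. Write \<open>c = g + m / \<kappa>\<close> for the focal surface, \<open>n\<close> for its unit
normal, and \<open>V = - v a (1, 0) + b (0, 1)\<close> for the principal vector.

Differentiating the quadratic equation of \<open>\<kappa>\<close> shows that the vanishing of the secondary cuspidal
curvature forces \<open>Dv \<kappa> = 0\<close> along the axis (\<open>Dv_kappa_axis\<close>). Hence \<open>Dv c = 0\<close> there, and then
\<open>Dv n = 0\<close> as well, because \<open>Dv n\<close> is orthogonal to the frame \<open>Du c, m, n\<close>. On the other hand,
Rodrigues' formula gives \<open>dc(V) = V(1 / \<kappa>) m\<close> (\<open>focal_image_of_principal_direction\<close>). The first order
ridge condition says that \<open>V \<kappa>\<close> vanishes at the origin to exactly first order in \<open>v\<close>, and this makes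
\<open>Du c, Dv c / v, n\<close> linearly independent there (\<open>focal_det_at_0\<close>).

These facts form a normal form, \<open>pure_frontal_chart\<close>, from which the conclusions can be read off:
the singular set is the axis, with null direction \<open>(0, 1)\<close>; the normal is stationary in that
direction, so the points are pure-frontal; and the factors \<open>v\<^sup>2\<close> cancel from the Gaussian and mean
curvature, which are therefore bounded. Finally the coordinate change carries all this to
\<open>C = c \<circ> \<Psi>\<close>; the curve \<open>\<gamma>\<close> parametrises the axis near the origin and so is a singular curve of \<open>C\<close>.
\<close>

section \<open>Smooth maps\<close>

lemma Ck_on_cong:
  assumes "open S" "Ck_on k S f" "\<And>x. x \<in> S \<Longrightarrow> f x = g x"
  shows "Ck_on k S g"
  using assms(2,3)
proof (induction k arbitrary: f g)
  case 0
  then show ?case using continuous_on_cong by (metis Ck_on.simps(1))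
next
  case (Suc k)
  have der: "(g has_derivative frechet_derivative f (at x)) (at x)" if "x \<in> S" for x
  proof -
    have "(f has_derivative frechet_derivative f (at x)) (at x)"
      using Suc.prems(1) that frechet_derivative_works by auto
    then show ?thesis
      using has_derivative_transform_within_open \<open>open S\<close> that Suc.prems(2) by metis
  qed
  have "Ck_on k S (\<lambda>x. frechet_derivative g (at x) X)" for X
  proof (rule Suc.IH)
    show "Ck_on k S (\<lambda>x. frechet_derivative f (at x) X)" using Suc.prems(1) by simp
    show "frechet_derivative f (at x) X = frechet_derivative g (at x) X" if "x \<in> S" for x
      by (subst frechet_derivative_at[OF der[OF that]]) (rule refl)
  qed
  then show ?case using der by (auto simp: differentiable_def)
qed

text \<open>The closure properties below follow by induction on the order from this rule, which accepts the
total derivative in whatever form the matching differentiation rule yields it.\<close>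

lemma Ck_onI_Suc:
  assumes "open S" "\<And>x. x \<in> S \<Longrightarrow> (f has_derivative f' x) (at x)"
    and "\<And>X. Ck_on k S (\<lambda>x. f' x X)"
  shows "Ck_on (Suc k) S f"
proof -
  have eq: "f' x = frechet_derivative f (at x)" if "x \<in> S" for x
    by (rule frechet_derivative_at[OF assms(2)[OF that]])
  have "Ck_on k S (\<lambda>x. frechet_derivative f (at x) X)" for X
    by (rule Ck_on_cong[OF assms(1) assms(3)]) (simp add: eq)
  then show ?thesis using assms(2) by (auto simp: differentiable_def)
qed

lemma Ck_on_has_derivative:
  "Ck_on (Suc k) S f \<Longrightarrow> x \<in> S \<Longrightarrow> (f has_derivative frechet_derivative f (at x)) (at x)"
  using frechet_derivative_works by auto

lemma Ck_on_Suc_D: "Ck_on (Suc k) S f \<Longrightarrow> Ck_on k S f"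
proof (induction k arbitrary: f)
  case 0
  then show ?case
    by (auto intro!: continuous_at_imp_continuous_on differentiable_imp_continuous_within)
qed auto

lemma Ck_on_subset: "Ck_on k S f \<Longrightarrow> T \<subseteq> S \<Longrightarrow> Ck_on k T f"
  by (induction k arbitrary: f) (auto intro: continuous_on_subset)

lemma Ck_on_const: "open S \<Longrightarrow> Ck_on k S (\<lambda>x. c)"
  by (induction k arbitrary: c) (auto intro!: Ck_onI_Suc)

lemma Ck_on_linear: "open S \<Longrightarrow> bounded_linear T \<Longrightarrow> Ck_on k S T"
proof (cases k)
  case 0
  assume "bounded_linear T" then show ?thesis using 0 by (simp add: linear_continuous_on)
next
  case (Suc l)
  assume "open S" "bounded_linear T" then show ?thesis
    unfolding Suc by (intro Ck_onI_Suc[where f' = "\<lambda>x. T"])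
      (auto intro: bounded_linear_imp_has_derivative Ck_on_const)
qed

lemma Ck_on_linear_comp:
  assumes "open S" "bounded_linear T"
  shows "Ck_on k S f \<Longrightarrow> Ck_on k S (\<lambda>x. T (f x))"
proof (induction k arbitrary: f)
  case 0 then show ?case using assms(2)
    by (auto intro: bounded_linear.continuous_on)
next
  case (Suc k)
  show ?case
    by (rule Ck_onI_Suc[OF assms(1), where f' = "\<lambda>x X. T (frechet_derivative f (at x) X)"])
      (use Suc Ck_on_has_derivative[OF Suc.prems] in \<open>auto intro: bounded_linear.has_derivative[OF assms(2)]\<close>)
qed

lemma Ck_on_add:
  assumes "open S"
  shows "Ck_on k S f \<Longrightarrow> Ck_on k S g \<Longrightarrow> Ck_on k S (\<lambda>x. f x + g x)"
proof (induction k arbitrary: f g)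
  case 0 then show ?case by (auto intro: continuous_intros)
next
  case (Suc k)
  show ?case
    by (rule Ck_onI_Suc[OF assms(1), where f' = "\<lambda>x X. frechet_derivative f (at x) X + frechet_derivative g (at x) X"])
      (use Suc Ck_on_has_derivative[OF Suc.prems(1)] Ck_on_has_derivative[OF Suc.prems(2)]
        in \<open>auto intro: has_derivative_add\<close>)
qed

lemma Ck_on_bilinear:
  assumes "open S" "bounded_bilinear b"
  shows "Ck_on k S f \<Longrightarrow> Ck_on k S g \<Longrightarrow> Ck_on k S (\<lambda>x. b (f x) (g x))"
proof (induction k arbitrary: f g)
  case 0 then show ?case using assms(2) by (auto intro: bounded_bilinear.continuous_on)
next
  case (Suc k)
  note [simp del] = Ck_on.simps
  show ?case
  proof (rule Ck_onI_Suc[OF assms(1)])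
    show "((\<lambda>x. b (f x) (g x)) has_derivative
        (\<lambda>X. b (f x) (frechet_derivative g (at x) X) + b (frechet_derivative f (at x) X) (g x))) (at x)"
      if "x \<in> S" for x
      by (rule bounded_bilinear.FDERIV[OF assms(2) Ck_on_has_derivative[OF Suc.prems(1) that]
            Ck_on_has_derivative[OF Suc.prems(2) that]])
    show "Ck_on k S (\<lambda>x. b (f x) (frechet_derivative g (at x) X) + b (frechet_derivative f (at x) X) (g x))" for X
      using Suc.prems
      by (intro Ck_on_add[OF assms(1)] Suc.IH Ck_on_Suc_D[OF Suc.prems(1)] Ck_on_Suc_D[OF Suc.prems(2)])
        (simp_all add: Ck_on.simps)
  qed
qed

lemma Ck_on_sum:
  assumes "open S" "finite I"
  shows "(\<And>i. i \<in> I \<Longrightarrow> Ck_on k S (f i)) \<Longrightarrow> Ck_on k S (\<lambda>x. \<Sum>i\<in>I. f i x)"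
  using assms(2) by (induction I) (auto intro: Ck_on_add Ck_on_const assms(1))

text \<open>The chain rule differentiates the outer map in a direction that varies with the point;
  expanding that direction in a basis turns the derivative of the composition into a sum of
  products of fixed directional derivatives, to which the induction hypothesis applies.\<close>

lemma Ck_on_compose:
  fixes g :: "'a::real_normed_vector \<Rightarrow> 'b::euclidean_space" and f :: "'b \<Rightarrow> 'c::real_normed_vector"
  assumes "open S" "open T" "g ` S \<subseteq> T"
  shows "Ck_on k T f \<Longrightarrow> Ck_on k S g \<Longrightarrow> Ck_on k S (\<lambda>x. f (g x))"
  using assms(3)
proof (induction k arbitrary: f g)
  case 0 then show ?case by (auto intro: continuous_on_compose2)
next
  case (Suc k)
  have f: "(f has_derivative frechet_derivative f (at y)) (at y)" if "y \<in> T" for y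
    using Ck_on_has_derivative[OF Suc.prems(1) that] .
  have g: "(g has_derivative frechet_derivative g (at y)) (at y)" if "y \<in> S" for y
    using Ck_on_has_derivative[OF Suc.prems(2) that] .
  let ?f' = "\<lambda>x X. \<Sum>i\<in>Basis. (frechet_derivative g (at x) X \<bullet> i) *\<^sub>R frechet_derivative f (at (g x)) i"
  show ?case
  proof (rule Ck_onI_Suc[OF assms(1), where f' = ?f'])
    fix x assume x: "x \<in> S"
    have "((f \<circ> g) has_derivative (frechet_derivative f (at (g x)) \<circ> frechet_derivative g (at x))) (at x)"
      using x Suc.prems(3) by (intro diff_chain_at f g) auto
    moreover have "frechet_derivative f (at (g x)) \<circ> frechet_derivative g (at x) = ?f' x"
    proof
      fix X
      let ?y = "frechet_derivative g (at x) X"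
      have lin: "linear (frechet_derivative f (at (g x)))"
        using f[of "g x"] x Suc.prems(3) has_derivative_linear by blast
      have "frechet_derivative f (at (g x)) ?y = frechet_derivative f (at (g x)) (\<Sum>i\<in>Basis. (?y \<bullet> i) *\<^sub>R i)"
        by (simp add: euclidean_representation)
      also have "\<dots> = ?f' x X"
        by (simp add: linear_sum[OF lin] linear_scale[OF lin])
      finally show "(frechet_derivative f (at (g x)) \<circ> frechet_derivative g (at x)) X = ?f' x X" by simp
    qed
    ultimately show "((\<lambda>x. f (g x)) has_derivative ?f' x) (at x)" by (simp add: o_def)
  next
    fix X
    have 1: "Ck_on k S (\<lambda>x. frechet_derivative f (at (g x)) i)" for i
      by (rule Suc.IH[of "\<lambda>y. frechet_derivative f (at y) i" g])
        (use Suc.prems Ck_on_Suc_D[OF Suc.prems(2)] in auto)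
    have 2: "Ck_on k S (\<lambda>x. frechet_derivative g (at x) X \<bullet> i)" for i
      using Suc.prems(2) by (intro Ck_on_linear_comp[OF assms(1) bounded_linear_inner_left]) auto
    show "Ck_on k S (\<lambda>x. ?f' x X)"
      by (intro Ck_on_sum Ck_on_bilinear[OF _ bounded_bilinear_scaleR] assms(1) 1 2) auto
  qed
qed

lemma smooth_on_cong:
  "open S \<Longrightarrow> smooth_on S f \<Longrightarrow> (\<And>x. x \<in> S \<Longrightarrow> f x = g x) \<Longrightarrow> smooth_on S g"
  unfolding smooth_on_def using Ck_on_cong by blast

lemma smooth_on_subset: "smooth_on S f \<Longrightarrow> T \<subseteq> S \<Longrightarrow> smooth_on T f"
  unfolding smooth_on_def using Ck_on_subset by blast

lemma smooth_on_const: "open S \<Longrightarrow> smooth_on S (\<lambda>x. c)"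
  by (simp add: smooth_on_def Ck_on_const)

lemma smooth_on_linear: "open S \<Longrightarrow> bounded_linear T \<Longrightarrow> smooth_on S T"
  by (simp add: smooth_on_def Ck_on_linear)

lemma smooth_on_linear_comp: "open S \<Longrightarrow> bounded_linear T \<Longrightarrow> smooth_on S f \<Longrightarrow> smooth_on S (\<lambda>x. T (f x))"
  by (simp add: smooth_on_def Ck_on_linear_comp)

lemma smooth_on_add: "open S \<Longrightarrow> smooth_on S f \<Longrightarrow> smooth_on S g \<Longrightarrow> smooth_on S (\<lambda>x. f x + g x)"
  by (simp add: smooth_on_def Ck_on_add)

lemma smooth_on_uminus: "open S \<Longrightarrow> smooth_on S f \<Longrightarrow> smooth_on S (\<lambda>x. - f x)"
  using smooth_on_linear_comp[OF _ bounded_linear_minus[OF bounded_linear_ident]] .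

lemma smooth_on_diff: "open S \<Longrightarrow> smooth_on S f \<Longrightarrow> smooth_on S g \<Longrightarrow> smooth_on S (\<lambda>x. f x - g x)"
  using smooth_on_add[OF _ _ smooth_on_uminus, of S f g] by simp

lemma smooth_on_bilinear:
  "open S \<Longrightarrow> bounded_bilinear b \<Longrightarrow> smooth_on S f \<Longrightarrow> smooth_on S g \<Longrightarrow> smooth_on S (\<lambda>x. b (f x) (g x))"
  by (simp add: smooth_on_def Ck_on_bilinear)

lemmas smooth_on_scaleR = smooth_on_bilinear[OF _ bounded_bilinear_scaleR]
  and smooth_on_inner = smooth_on_bilinear[OF _ bounded_bilinear_inner]
  and smooth_on_mult = smooth_on_bilinear[OF _ bounded_bilinear_mult]

lemma smooth_on_power2:
  fixes f :: "'a::real_normed_vector \<Rightarrow> real"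
  shows "open S \<Longrightarrow> smooth_on S f \<Longrightarrow> smooth_on S (\<lambda>x. (f x)\<^sup>2)"
  using smooth_on_bilinear[OF _ bounded_bilinear_mult] by (simp add: power2_eq_square)

lemma smooth_on_compose:
  fixes g :: "'a::real_normed_vector \<Rightarrow> 'b::euclidean_space" and f :: "'b \<Rightarrow> 'c::real_normed_vector"
  assumes "open S" "open T" "g ` S \<subseteq> T" "smooth_on T f" "smooth_on S g"
  shows "smooth_on S (\<lambda>x. f (g x))"
  using assms Ck_on_compose unfolding smooth_on_def by metis

lemma smooth_on_imp_has_derivative:
  "smooth_on S f \<Longrightarrow> x \<in> S \<Longrightarrow> (f has_derivative frechet_derivative f (at x)) (at x)"
  unfolding smooth_on_def using Ck_on_has_derivative by blast

lemma smooth_on_imp_differentiable: "smooth_on S f \<Longrightarrow> x \<in> S \<Longrightarrow> f differentiable (at x)"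
  using smooth_on_imp_has_derivative differentiableI by blast

lemma smooth_on_imp_continuous_on: "smooth_on S f \<Longrightarrow> continuous_on S f"
  unfolding smooth_on_def using Ck_on.simps(1) by blast

lemma smooth_on_frechet_derivative:
  "smooth_on S f \<Longrightarrow> smooth_on S (\<lambda>x. frechet_derivative f (at x) X)"
  unfolding smooth_on_def using Ck_on.simps(2) by blast

lemma smooth_on_inverse_ident: "smooth_on (- {0}) (inverse :: real \<Rightarrow> real)"
proof -
  have "Ck_on k (- {0}) (inverse :: real \<Rightarrow> real)" for k
  proof (induction k)
    case 0 show ?case by (auto intro: continuous_intros)
  next
    case (Suc k)
    show ?case
    proof (rule Ck_onI_Suc)
      show "(inverse has_derivative (\<lambda>X. - (inverse x * X * inverse x))) (at x)" if "x \<in> - {0::real}" for x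
        using that by (intro has_derivative_inverse') auto
      fix X :: real
      have "Ck_on k (- {0}) (\<lambda>x::real. inverse x * (- X) * inverse x)"
        by (intro Ck_on_bilinear[OF _ bounded_bilinear_mult] Suc Ck_on_const) auto
      then show "Ck_on k (- {0}) (\<lambda>x. - (inverse x * X * inverse x))" by simp
    qed auto
  qed
  then show ?thesis by (simp add: smooth_on_def)
qed

lemma smooth_on_inverse:
  fixes f :: "'a::real_normed_vector \<Rightarrow> real"
  assumes "open S" "smooth_on S f" "\<And>x. x \<in> S \<Longrightarrow> f x \<noteq> 0"
  shows "smooth_on S (\<lambda>x. inverse (f x))"
  using assms by (intro smooth_on_compose[OF _ _ _ smooth_on_inverse_ident]) auto

lemma smooth_on_divide:
  fixes f :: "'a::real_normed_vector \<Rightarrow> real"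
  assumes "open S" "smooth_on S f" "smooth_on S g" "\<And>x. x \<in> S \<Longrightarrow> g x \<noteq> 0"
  shows "smooth_on S (\<lambda>x. f x / g x)"
  unfolding divide_inverse using assms
  by (intro smooth_on_bilinear[OF _ bounded_bilinear_mult] smooth_on_inverse) auto

lemma smooth_on_sqrt_ident: "smooth_on {0<..} sqrt"
proof -
  have "Ck_on k {0<..} sqrt" for k
  proof (induction k)
    case 0 show ?case by (auto intro: continuous_intros)
  next
    case (Suc k)
    show ?case
    proof (rule Ck_onI_Suc)
      show "(sqrt has_derivative (*) (inverse (sqrt x) / 2)) (at x)" if "x \<in> {0<..}" for x
        using that DERIV_real_sqrt[of x] by (simp add: has_field_derivative_def)
      fix X :: real
      have "Ck_on k {0<..} (\<lambda>x. inverse (sqrt x))"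
        using smooth_on_inverse_ident
        by (intro Ck_on_compose[where T = "- {0}", OF _ _ _ _ Suc]) (auto simp: smooth_on_def)
      then have "Ck_on k {0<..} (\<lambda>x. (X / 2) * inverse (sqrt x))"
        by (intro Ck_on_bilinear[OF _ bounded_bilinear_mult] Ck_on_const) auto
      then show "Ck_on k {0<..} (\<lambda>x. inverse (sqrt x) / 2 * X)" by (simp add: mult.commute)
    qed auto
  qed
  then show ?thesis by (simp add: smooth_on_def)
qed

lemma smooth_on_sqrt:
  assumes "open S" "smooth_on S f" "\<And>x. x \<in> S \<Longrightarrow> f x > 0"
  shows "smooth_on S (\<lambda>x. sqrt (f x))"
  using assms by (intro smooth_on_compose[OF _ _ _ smooth_on_sqrt_ident]) auto

section \<open>Partial derivatives in the plane\<close>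

lemma plane_decomp: "X = X $ 1 *\<^sub>R axis 1 1 + X $ 2 *\<^sub>R axis 2 (1::real)" for X :: "real^2"
  by (simp add: vec_eq_iff forall_2 axis_def)

lemma plane_eqI: "X $ 1 = Y $ 1 \<Longrightarrow> X $ 2 = Y $ 2 \<Longrightarrow> X = Y" for X Y :: "real^2"
  by (simp add: vec_eq_iff forall_2)

lemma axis_nth2 [simp]:
  "(axis 1 1 :: real^2) $ 1 = 1" "(axis 1 1 :: real^2) $ 2 = 0"
  "(axis 2 1 :: real^2) $ 1 = 0" "(axis 2 1 :: real^2) $ 2 = 1"
  by (simp_all add: axis_def)

lemma frechet_derivative_plane:
  assumes "f differentiable (at q)"
  shows "frechet_derivative f (at q) X = X $ 1 *\<^sub>R Du f q + X $ 2 *\<^sub>R Dv f q"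
proof -
  have lin: "linear (frechet_derivative f (at q))"
    using assms linear_frechet_derivative by blast
  show ?thesis
    by (subst plane_decomp[of X]) (simp add: Du_def Dv_def linear_add[OF lin] linear_scale[OF lin])
qed

lemma has_derivative_plane:
  "f differentiable (at q) \<Longrightarrow> (f has_derivative (\<lambda>X. X $ 1 *\<^sub>R Du f q + X $ 2 *\<^sub>R Dv f q)) (at q)"
  using frechet_derivative_plane frechet_derivative_works
  by (metis (no_types, lifting) has_derivative_eq_rhs ext)

lemma Du_eqI: "(f has_derivative f') (at q) \<Longrightarrow> Du f q = f' (axis 1 1)"
  and Dv_eqI: "(f has_derivative f') (at q) \<Longrightarrow> Dv f q = f' (axis 2 1)"
  unfolding Du_def Dv_def by (drule frechet_derivative_at, simp)+

lemma Du_cong: "open S \<Longrightarrow> q \<in> S \<Longrightarrow> f differentiable (at q) \<Longrightarrow> (\<And>x. x \<in> S \<Longrightarrow> f x = g x) \<Longrightarrow> Du f q = Du g q"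
  and Dv_cong: "open S \<Longrightarrow> q \<in> S \<Longrightarrow> f differentiable (at q) \<Longrightarrow> (\<And>x. x \<in> S \<Longrightarrow> f x = g x) \<Longrightarrow> Dv f q = Dv g q"
  unfolding Du_def Dv_def by (metis frechet_derivative_transform_within_open)+

lemma D_const: "Du (\<lambda>x. c) q = 0" "Dv (\<lambda>x. c) q = 0"
  by (simp_all add: Du_def Dv_def)

lemma D_bilinear:
  assumes "bounded_bilinear b" "f differentiable (at q)" "g differentiable (at q)"
  shows "Du (\<lambda>x. b (f x) (g x)) q = b (f q) (Du g q) + b (Du f q) (g q)"
    and "Dv (\<lambda>x. b (f x) (g x)) q = b (f q) (Dv g q) + b (Dv f q) (g q)"
  using bounded_bilinear.FDERIV[OF assms(1) has_derivative_plane[OF assms(2)] has_derivative_plane[OF assms(3)]]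
  by (auto dest: Du_eqI Dv_eqI)

lemmas D_inner = D_bilinear[OF bounded_bilinear_inner]
  and D_scaleR = D_bilinear[OF bounded_bilinear_scaleR]
  and D_mult = D_bilinear[OF bounded_bilinear_mult]

lemma D_add:
  assumes "f differentiable (at q)" "g differentiable (at q)"
  shows "Du (\<lambda>x. f x + g x) q = Du f q + Du g q" "Dv (\<lambda>x. f x + g x) q = Dv f q + Dv g q"
  using has_derivative_add[OF has_derivative_plane[OF assms(1)] has_derivative_plane[OF assms(2)]]
  by (auto dest: Du_eqI Dv_eqI)

lemma D_minus:
  assumes "f differentiable (at q)"
  shows "Du (\<lambda>x. - f x) q = - Du f q" "Dv (\<lambda>x. - f x) q = - Dv f q"
  using has_derivative_minus[OF has_derivative_plane[OF assms(1)]]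
  by (auto dest: Du_eqI Dv_eqI)

lemma D_coord2: "Du (\<lambda>q. q $ 2) q = 0" "Dv (\<lambda>q. q $ 2) q = 1"
  using bounded_linear_imp_has_derivative[OF bounded_linear_vec_nth[of 2], of "at q"]
  by (auto dest: Du_eqI Dv_eqI)

lemma smooth_on_Du: "smooth_on S f \<Longrightarrow> smooth_on S (Du f)"
  and smooth_on_Dv: "smooth_on S f \<Longrightarrow> smooth_on S (Dv f)"
  unfolding Du_def[abs_def] Dv_def[abs_def] by (rule smooth_on_frechet_derivative; assumption)+

lemma smooth_on_coord: "open S \<Longrightarrow> smooth_on S (\<lambda>q. q $ i)"
  by (intro smooth_on_linear bounded_linear_vec_nth)

lemma Ck_on_planeI:
  assumes "open S" "\<And>x. x \<in> S \<Longrightarrow> (f has_derivative (\<lambda>X. X $ 1 *\<^sub>R a x + X $ 2 *\<^sub>R b x)) (at x)"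
    and "Ck_on k S a" "Ck_on k S b"
  shows "Ck_on (Suc k) S f"
  by (rule Ck_onI_Suc[OF assms(1,2)], assumption)
    (intro Ck_on_add Ck_on_linear_comp[OF assms(1) bounded_linear_scaleR_right] assms)

text \<open>Off the \<open>u\<close>-axis a relation multiplied by \<open>v\<close> may be divided by \<open>v\<close>; since the axis has empty
interior, continuity carries the quotient relation over to the axis.\<close>

lemma zero_off_axis_imp_zero:
  fixes f :: "real^2 \<Rightarrow> 'b::real_normed_vector"
  assumes "open S" "continuous_on S f" "\<And>x. x \<in> S \<Longrightarrow> x $ 2 \<noteq> 0 \<Longrightarrow> f x = 0" "q \<in> S"
  shows "f q = 0"
proof (cases "q $ 2 = 0")
  case True
  let ?p = "\<lambda>s::real. q + s *\<^sub>R axis 2 1"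
  have p: "(?p \<longlongrightarrow> q) (at 0)"
    by (auto intro!: tendsto_eq_intros)
  have "isCont f q"
    using assms(1,2,4) continuous_on_eq_continuous_at by blast
  then have "((\<lambda>s. f (?p s)) \<longlongrightarrow> f q) (at 0)"
    using p isCont_tendsto_compose by blast
  moreover have "\<forall>\<^sub>F s in at 0. f (?p s) = 0"
  proof -
    have "\<forall>\<^sub>F s in at 0. ?p s \<in> S"
      using p assms(1,4) topological_tendstoD by blast
    moreover have "\<forall>\<^sub>F s in at (0::real). s \<noteq> 0"
      by (simp add: eventually_at_filter)
    ultimately show ?thesis
      by eventually_elim (use True in \<open>auto intro!: assms(3)\<close>)
  qed
  ultimately have "((\<lambda>s. 0) \<longlongrightarrow> f q) (at (0::real))"
    by (rule Lim_transform_eventually)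
  then show ?thesis by (simp add: tendsto_const_iff)
qed (use assms in blast)

section \<open>Division by a coordinate\<close>

definition squeeze :: "real \<Rightarrow> real^2 \<Rightarrow> real^2" where
  "squeeze t q = q $ 1 *\<^sub>R axis 1 1 + (t * q $ 2) *\<^sub>R axis 2 1"

text \<open>Hadamard's lemma: if \<open>\<phi>\<close> vanishes on the \<open>u\<close>-axis, then \<open>\<phi>(u, v) / v\<close> equals the mean over
\<open>t \<in> [0, 1]\<close> of \<open>Dv \<phi>(u, t v)\<close>. The weight \<open>t ^ k\<close> in \<open>fibre_mean\<close> makes this class of integrals
closed under differentiation, because \<open>Dv\<close> brings out one more factor \<open>t\<close>; this is what makes the
quotient smooth to every order.\<close>

definition fibre_mean :: "nat \<Rightarrow> (real^2 \<Rightarrow> 'b::euclidean_space) \<Rightarrow> real^2 \<Rightarrow> 'b" where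
  "fibre_mean k \<phi> q = integral (cbox 0 1) (\<lambda>t. t ^ k *\<^sub>R \<phi> (squeeze t q))"

lemma squeeze_nth [simp]: "squeeze t q $ 1 = q $ 1" "squeeze t q $ 2 = t * q $ 2"
  by (simp_all add: squeeze_def)

lemma squeeze_1 [simp]: "squeeze 1 q = q"
  by (rule plane_eqI) simp_all

lemma squeeze_axis: "q $ 2 = 0 \<Longrightarrow> squeeze t q = q"
  by (rule plane_eqI) simp_all

lemma norm_squeeze: "0 \<le> t \<Longrightarrow> t \<le> 1 \<Longrightarrow> norm (squeeze t q) \<le> norm q"
  unfolding norm_vec_def L2_set_def
  by (simp add: sum_2 power_mult_distrib mult_left_le_one_le power_le_one)

lemma squeeze_in_ball: "q \<in> ball 0 r \<Longrightarrow> t \<in> cbox 0 1 \<Longrightarrow> squeeze t q \<in> ball 0 r"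
  using norm_squeeze[of t q] by (auto simp: dist_norm)

lemma continuous_on_squeeze: "continuous_on A (\<lambda>(q, t). squeeze t q)"
  unfolding squeeze_def case_prod_beta by (intro continuous_intros)

lemma squeeze_has_derivative:
  "(squeeze t has_derivative (\<lambda>X. X $ 1 *\<^sub>R axis 1 1 + (t * X $ 2) *\<^sub>R axis 2 1)) (at q within A)"
  unfolding squeeze_def[abs_def]
  by (intro bounded_linear_imp_has_derivative bounded_linear_add bounded_linear_scaleR_const
      bounded_linear_const_mult bounded_linear_vec_nth)

lemma continuous_on_comp_squeeze:
  assumes "continuous_on (ball 0 r) \<phi>"
  shows "continuous_on (ball 0 r \<times> cbox 0 1) (\<lambda>(q, t). \<phi> (squeeze t q))"
proof -
  have "continuous_on (ball 0 r \<times> cbox 0 1) (\<lambda>z. \<phi> ((\<lambda>(q, t). squeeze t q) z))"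
    by (rule continuous_on_compose2[OF assms continuous_on_squeeze]) (auto intro: squeeze_in_ball)
  then show ?thesis by (simp add: case_prod_beta)
qed

lemma fibre_mean_has_derivative:
  fixes \<phi> :: "real^2 \<Rightarrow> 'b::euclidean_space"
  assumes sm: "smooth_on (ball 0 r) \<phi>" and q: "q \<in> ball 0 r"
  shows "(fibre_mean k \<phi> has_derivative
    (\<lambda>X. X $ 1 *\<^sub>R fibre_mean k (Du \<phi>) q + X $ 2 *\<^sub>R fibre_mean (Suc k) (Dv \<phi>) q)) (at q)"
proof -
  \<comment> \<open>The Leibniz rule asks for the derivative of the integrand as a continuous family of bounded
  linear maps, hence the detour through \<open>Blinfun\<close>.\<close>
  define P where "P i = Blinfun (\<lambda>X::real^2. X $ i)" for i
  have P: "blinfun_apply (P i) X = X $ i" for i X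
    by (simp add: P_def bounded_linear_Blinfun_apply bounded_linear_vec_nth)
  define F where "F q t = (blinfun_scaleR_left (t ^ k *\<^sub>R Du \<phi> (squeeze t q)) o\<^sub>L P 1)
      + (blinfun_scaleR_left (t ^ Suc k *\<^sub>R Dv \<phi> (squeeze t q)) o\<^sub>L P 2)" for q t
  have F: "blinfun_apply (F q t) X =
      t ^ k *\<^sub>R (X $ 1 *\<^sub>R Du \<phi> (squeeze t q) + (t * X $ 2) *\<^sub>R Dv \<phi> (squeeze t q))" for q t X
    by (simp add: F_def P blinfun.add_left scaleR_add_right ac_simps)
  have cu: "continuous_on (ball 0 r \<times> cbox 0 1) (\<lambda>z. Du \<phi> (squeeze (snd z) (fst z)))"
    and cv: "continuous_on (ball 0 r \<times> cbox 0 1) (\<lambda>z. Dv \<phi> (squeeze (snd z) (fst z)))"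
    and c: "continuous_on (ball 0 r \<times> cbox 0 1) (\<lambda>z. \<phi> (squeeze (snd z) (fst z)))"
    using continuous_on_comp_squeeze[OF smooth_on_imp_continuous_on] sm smooth_on_Du smooth_on_Dv
    unfolding case_prod_beta by blast+
  have contF: "continuous_on (ball 0 r \<times> cbox 0 1) (\<lambda>(q, t). F q t)"
    unfolding F_def case_prod_beta
    by (intro continuous_intros bounded_linear.continuous_on[OF bounded_linear_blinfun_scaleR_left] cu cv)
  have slice: "continuous_on (cbox 0 1) (\<lambda>t. G q t)" if "continuous_on (ball 0 r \<times> cbox 0 1) (\<lambda>(q, t). G q t)"
    "q \<in> ball 0 r" for q and G :: "real^2 \<Rightarrow> real \<Rightarrow> 'z::topological_space"
  proof -
    have "continuous_on (cbox 0 1) (\<lambda>t. (\<lambda>(q, t). G q t) (q, t))"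
      by (rule continuous_on_compose2[OF that(1)]) (use that(2) in \<open>auto intro!: continuous_intros\<close>)
    then show ?thesis by simp
  qed
  have der: "((\<lambda>q. integral (cbox 0 1) (\<lambda>t. t ^ k *\<^sub>R \<phi> (squeeze t q))) has_derivative
      blinfun_apply (integral (cbox 0 1) (F q))) (at q within ball 0 r)"
  proof (rule leibniz_rule[OF _ _ contF q convex_ball])
    fix x :: "real^2" and t :: real assume x: "x \<in> ball 0 r" and t: "t \<in> cbox 0 1"
    have "(\<phi> has_derivative (\<lambda>X. X $ 1 *\<^sub>R Du \<phi> (squeeze t x) + X $ 2 *\<^sub>R Dv \<phi> (squeeze t x))) (at (squeeze t x))"
      using has_derivative_plane smooth_on_imp_differentiable[OF sm squeeze_in_ball[OF x t]] by blast
    from has_derivative_compose[OF squeeze_has_derivative this]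
    have "((\<lambda>x. \<phi> (squeeze t x)) has_derivative
       (\<lambda>X. X $ 1 *\<^sub>R Du \<phi> (squeeze t x) + (t * X $ 2) *\<^sub>R Dv \<phi> (squeeze t x))) (at x within ball 0 r)"
      by simp
    then show "((\<lambda>x. t ^ k *\<^sub>R \<phi> (squeeze t x)) has_derivative blinfun_apply (F x t)) (at x within ball 0 r)"
      unfolding F by (rule has_derivative_scaleR_right)
  next
    fix x :: "real^2" assume x: "x \<in> ball 0 r"
    have "continuous_on (ball 0 r \<times> cbox 0 1) (\<lambda>(q, t). t ^ k *\<^sub>R \<phi> (squeeze t q))"
      unfolding case_prod_beta by (intro continuous_intros c)
    from integrable_continuous[OF slice[OF this x]]
    show "(\<lambda>t. t ^ k *\<^sub>R \<phi> (squeeze t x)) integrable_on cbox 0 1" .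
  qed
  have at_q: "at q within ball 0 r = at q" by (rule at_within_open[OF q open_ball])
  have eq: "blinfun_apply (integral (cbox 0 1) (F q)) X =
      X $ 1 *\<^sub>R fibre_mean k (Du \<phi>) q + X $ 2 *\<^sub>R fibre_mean (Suc k) (Dv \<phi>) q" for X
  proof -
    have i1: "(\<lambda>t. t ^ k *\<^sub>R Du \<phi> (squeeze t q)) integrable_on cbox 0 1"
      and i2: "(\<lambda>t. t ^ Suc k *\<^sub>R Dv \<phi> (squeeze t q)) integrable_on cbox 0 1"
      by (rule integrable_continuous, rule slice[OF _ q], unfold case_prod_beta,
          intro continuous_intros cu cv)+
    have "blinfun_apply (integral (cbox 0 1) (F q)) X = integral (cbox 0 1) (\<lambda>t. blinfun_apply (F q t) X)"
      by (rule blinfun_apply_integral) (rule integrable_continuous[OF slice[OF contF q]])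
    also have "(\<lambda>t. blinfun_apply (F q t) X) =
        (\<lambda>t. X $ 1 *\<^sub>R (t ^ k *\<^sub>R Du \<phi> (squeeze t q)) + X $ 2 *\<^sub>R (t ^ Suc k *\<^sub>R Dv \<phi> (squeeze t q)))"
      unfolding F by (auto simp: scaleR_add_right ac_simps)
    also have "integral (cbox 0 1) \<dots> = X $ 1 *\<^sub>R fibre_mean k (Du \<phi>) q + X $ 2 *\<^sub>R fibre_mean (Suc k) (Dv \<phi>) q"
      unfolding fibre_mean_def
      by (simp only: Henstock_Kurzweil_Integration.integral_add[OF integrable_cmul[OF i1] integrable_cmul[OF i2]]
          integral_cmul)
    finally show ?thesis .
  qed
  have "fibre_mean k \<phi> = (\<lambda>q. integral (cbox 0 1) (\<lambda>t. t ^ k *\<^sub>R \<phi> (squeeze t q)))"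
    by (rule ext) (rule fibre_mean_def)
  then show ?thesis
    using has_derivative_eq_rhs[OF der[unfolded at_q] ext[OF eq]] by simp
qed

lemma smooth_on_fibre_mean:
  fixes \<phi> :: "real^2 \<Rightarrow> 'b::euclidean_space"
  assumes "smooth_on (ball 0 r) \<phi>"
  shows "smooth_on (ball 0 r) (fibre_mean k \<phi>)"
proof -
  have "Ck_on n (ball 0 r) (fibre_mean k \<phi>)" if "smooth_on (ball 0 r) \<phi>"
    for n k and \<phi> :: "real^2 \<Rightarrow> 'b"
    using that
  proof (induction n arbitrary: k \<phi>)
    case 0
    then show ?case
      by (auto intro!: continuous_at_imp_continuous_on has_derivative_continuous[OF fibre_mean_has_derivative])
  next
    case (Suc n)
    show ?case
      by (rule Ck_on_planeI[OF open_ball fibre_mean_has_derivative[OF Suc.prems]])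
        (auto intro: Suc smooth_on_Du smooth_on_Dv)
  qed
  then show ?thesis using assms by (simp add: smooth_on_def)
qed

lemma fibre_mean_axis: "q $ 2 = 0 \<Longrightarrow> fibre_mean 0 \<phi> q = \<phi> q"
  by (simp add: fibre_mean_def squeeze_axis)

text \<open>The fundamental theorem of calculus on the vertical segment that joins the axis to the point.\<close>

lemma fibre_mean_Dv:
  fixes \<phi> :: "real^2 \<Rightarrow> 'b::euclidean_space"
  assumes sm: "smooth_on (ball 0 r) \<phi>" and q: "q \<in> ball 0 r"
  shows "\<phi> q - \<phi> (squeeze 0 q) = q $ 2 *\<^sub>R fibre_mean 0 (Dv \<phi>) q"
proof -
  have "((\<lambda>t. q $ 2 *\<^sub>R Dv \<phi> (squeeze t q)) has_integral \<phi> (squeeze 1 q) - \<phi> (squeeze 0 q)) {0..1}"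
  proof (rule fundamental_theorem_of_calculus)
    fix t :: real assume t: "t \<in> {0..1}"
    have 1: "((\<lambda>t. squeeze t q) has_derivative (\<lambda>s. (s * q $ 2) *\<^sub>R axis 2 1)) (at t within {0..1})"
      unfolding squeeze_def by (auto intro!: derivative_eq_intros)
    have 2: "(\<phi> has_derivative (\<lambda>X. X $ 1 *\<^sub>R Du \<phi> (squeeze t q) + X $ 2 *\<^sub>R Dv \<phi> (squeeze t q))) (at (squeeze t q))"
      using has_derivative_plane smooth_on_imp_differentiable[OF sm squeeze_in_ball[OF q, of t]] t by auto
    show "((\<lambda>t. \<phi> (squeeze t q)) has_vector_derivative q $ 2 *\<^sub>R Dv \<phi> (squeeze t q)) (at t within {0..1})"
      using has_derivative_compose[OF 1 2] by (simp add: has_vector_derivative_def)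
  qed simp
  then have "integral (cbox 0 1) (\<lambda>t. q $ 2 *\<^sub>R Dv \<phi> (squeeze t q)) = \<phi> q - \<phi> (squeeze 0 q)"
    by (auto simp: has_integral_integrable_integral)
  then show ?thesis by (simp add: fibre_mean_def)
qed

text \<open>The two branches in the definition of \<open>Dv_over_v\<close> are one smooth function, because both agree with
an integral that depends smoothly on the point.\<close>

lemma Dv_over_v_eq_fibre_mean:
  assumes sm: "smooth_on (ball 0 r) g" and ax: "\<And>q. q \<in> ball 0 r \<Longrightarrow> q $ 2 = 0 \<Longrightarrow> Dv g q = 0"
    and q: "q \<in> ball 0 r"
  shows "Dv_over_v g q = fibre_mean 0 (Dv (Dv g)) q"
proof (cases "q $ 2 = 0")
  case False
  have "Dv g (squeeze 0 q) = 0"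
    using squeeze_in_ball[OF q, of 0] by (auto intro: ax)
  then show ?thesis
    using fibre_mean_Dv[OF smooth_on_Dv[OF sm] q] False by (simp add: Dv_over_v_def)
qed (simp add: Dv_over_v_def fibre_mean_axis)

lemma smooth_on_Dv_over_v:
  assumes "smooth_on (ball 0 r) g" "\<And>q. q \<in> ball 0 r \<Longrightarrow> q $ 2 = 0 \<Longrightarrow> Dv g q = 0"
  shows "smooth_on (ball 0 r) (Dv_over_v g)"
  by (rule smooth_on_cong[OF open_ball smooth_on_fibre_mean[OF smooth_on_Dv[OF smooth_on_Dv[OF assms(1)]]]])
    (rule Dv_over_v_eq_fibre_mean[OF assms, symmetric])

lemma Dv_eq_Dv_over_v: "(q $ 2 = 0 \<Longrightarrow> Dv g q = 0) \<Longrightarrow> Dv g q = q $ 2 *\<^sub>R Dv_over_v g q"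
  by (cases "q $ 2 = 0") (simp_all add: Dv_over_v_def)

text \<open>Off the axis, \<open>Du f(u, v) - Du f(u, 0)\<close> can be computed in two ways: by differentiating
\<open>f(u, v) - f(u, 0)\<close>, written as \<open>v\<close> times a fibre mean, or by applying \<open>fibre_mean_Dv\<close> to \<open>Du f\<close>. Hence
the fibre means of the two mixed derivatives agree there, and on the axis, where a fibre mean is
just the value, continuity gives the symmetry.\<close>

lemma Du_Dv_commute_axis:
  fixes f :: "real^2 \<Rightarrow> 'b::euclidean_space"
  assumes sm: "smooth_on (ball 0 r) f" and q: "q \<in> ball 0 r" "q $ 2 = 0"
  shows "Du (Dv f) q = Dv (Du f) q"
proof -
  let ?I = "\<lambda>\<phi>. fibre_mean 0 \<phi>"
  have "?I (Du (Dv f)) p - ?I (Dv (Du f)) p = 0" if p: "p \<in> ball 0 r" "p $ 2 \<noteq> 0" for p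
  proof -
    have df: "(f has_derivative (\<lambda>X. X $ 1 *\<^sub>R Du f x + X $ 2 *\<^sub>R Dv f x)) (at x)" if "x \<in> ball 0 r" for x
      using has_derivative_plane smooth_on_imp_differentiable[OF sm that] by blast
    have 1: "((\<lambda>p. f p - f (squeeze 0 p)) has_derivative
        (\<lambda>X. (X $ 1 *\<^sub>R Du f p + X $ 2 *\<^sub>R Dv f p) - X $ 1 *\<^sub>R Du f (squeeze 0 p))) (at p)"
      using has_derivative_diff[OF df[OF p(1)]
          has_derivative_compose[OF squeeze_has_derivative df[OF squeeze_in_ball[OF p(1), of 0]]]]
      by simp
    have "((\<lambda>p. p $ 2 *\<^sub>R ?I (Dv f) p) has_derivative
        (\<lambda>X. p $ 2 *\<^sub>R (X $ 1 *\<^sub>R ?I (Du (Dv f)) p + X $ 2 *\<^sub>R fibre_mean (Suc 0) (Dv (Dv f)) p)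
           + X $ 2 *\<^sub>R ?I (Dv f) p)) (at p)"
      by (rule has_derivative_scaleR[OF bounded_linear_imp_has_derivative[OF bounded_linear_vec_nth]
            fibre_mean_has_derivative[OF smooth_on_Dv[OF sm] p(1)]])
    then have 2: "((\<lambda>p. f p - f (squeeze 0 p)) has_derivative
        (\<lambda>X. p $ 2 *\<^sub>R (X $ 1 *\<^sub>R ?I (Du (Dv f)) p + X $ 2 *\<^sub>R fibre_mean (Suc 0) (Dv (Dv f)) p)
           + X $ 2 *\<^sub>R ?I (Dv f) p)) (at p)"
      by (rule has_derivative_transform_within_open[OF _ open_ball p(1)])
        (use fibre_mean_Dv[OF sm] in simp)
    have "p $ 2 *\<^sub>R ?I (Du (Dv f)) p = Du f p - Du f (squeeze 0 p)"
      using fun_cong[OF has_derivative_unique[OF 1 2], of "axis 1 1"] by simp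
    also have "\<dots> = p $ 2 *\<^sub>R ?I (Dv (Du f)) p"
      using fibre_mean_Dv[OF smooth_on_Du[OF sm] p(1)] .
    finally show ?thesis using p(2) by simp
  qed
  moreover have "continuous_on (ball 0 r) (\<lambda>p. ?I (Du (Dv f)) p - ?I (Dv (Du f)) p)"
    by (intro continuous_on_diff smooth_on_imp_continuous_on smooth_on_fibre_mean smooth_on_Du smooth_on_Dv sm)
  ultimately have "?I (Du (Dv f)) q - ?I (Dv (Du f)) q = 0"
    using zero_off_axis_imp_zero[OF open_ball, of 0 r _ q] q(1) by blast
  then show ?thesis using q(2) by (simp add: fibre_mean_axis)
qed

text \<open>Translating the point to the origin puts it on the axis.\<close>

lemma Du_Dv_commute:
  fixes f :: "real^2 \<Rightarrow> 'b::euclidean_space"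
  assumes S: "open S" "q \<in> S" and sm: "smooth_on S f"
  shows "Du (Dv f) q = Dv (Du f) q"
proof -
  obtain r where r: "r > 0" "ball q r \<subseteq> S" using S open_contains_ball by blast
  have shift: "x + q \<in> S" if "x \<in> ball 0 r" for x
    using that r(2) by (auto simp: dist_norm subset_eq norm_minus_commute)
  have Tr: "((\<lambda>x. x + q) has_derivative (\<lambda>X. X)) (at x)" for x :: "real^2"
    by (auto intro!: derivative_eq_intros)
  have D: "Du (\<lambda>x. g (x + q)) x = Du g (x + q)" "Dv (\<lambda>x. g (x + q)) x = Dv g (x + q)"
    "(\<lambda>x. g (x + q)) differentiable (at x)"
    if "smooth_on S g" "x \<in> ball 0 r" for g :: "real^2 \<Rightarrow> 'b" and x
    using has_derivative_compose[OF Tr has_derivative_plane[OF smooth_on_imp_differentiable[OF that(1) shift[OF that(2)]]]]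
    by (auto dest: Du_eqI Dv_eqI simp: differentiable_def)
  have "smooth_on (ball 0 r) (\<lambda>x. f (x + q))"
    by (rule smooth_on_compose[OF open_ball S(1) _ sm])
      (use shift in \<open>auto intro!: smooth_on_add[OF open_ball smooth_on_linear[OF open_ball bounded_linear_ident]]
        smooth_on_const\<close>)
  then have "Du (Dv (\<lambda>x. f (x + q))) 0 = Dv (Du (\<lambda>x. f (x + q))) 0"
    by (rule Du_Dv_commute_axis) (use r in auto)
  moreover have "Du (Dv (\<lambda>x. f (x + q))) 0 = Du (\<lambda>x. Dv f (x + q)) 0"
    by (rule sym, rule Du_cong[OF open_ball[of 0 r]]) (use r D D(3) smooth_on_Dv[OF sm] sm in auto)
  moreover have "Dv (Du (\<lambda>x. f (x + q))) 0 = Dv (\<lambda>x. Du f (x + q)) 0"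
    by (rule sym, rule Dv_cong[OF open_ball[of 0 r]]) (use r D D(3) smooth_on_Du[OF sm] sm in auto)
  ultimately show ?thesis
    using D(1)[OF smooth_on_Dv[OF sm], of 0] D(2)[OF smooth_on_Du[OF sm], of 0] r by simp
qed

section \<open>Determinants and singular points\<close>

lemma det3_expand:
  "det3 a b c = a$1 * (b$2 * c$3 - b$3 * c$2) - a$2 * (b$1 * c$3 - b$3 * c$1) + a$3 * (b$1 * c$2 - b$2 * c$1)"
  by (simp add: det3_def det_3 algebra_simps)

lemma inner_3: "a \<bullet> b = a$1 * b$1 + a$2 * b$2 + a$3 * b$3" for a b :: "real^3"
  by (simp add: inner_vec_def sum_3)

lemma det3_eq_inner_cross: "det3 a b c = a \<bullet> cross3 b c"
  by (simp add: det3_def dot_cross_det)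

lemma orthogonal_to_basis_imp_zero:
  assumes "det3 a b c \<noteq> 0" "w \<bullet> a = 0" "w \<bullet> b = 0" "w \<bullet> c = 0"
  shows "w = 0"
proof -
  have "det3 a b c *\<^sub>R w =
      (w \<bullet> a) *\<^sub>R cross3 b c + (w \<bullet> b) *\<^sub>R cross3 c a + (w \<bullet> c) *\<^sub>R cross3 a b"
    by (simp add: det3_expand inner_3 cross3_def vec_eq_iff forall_3 algebra_simps)
  then show ?thesis using assms by simp
qed

text \<open>The Gram determinant of \<open>a, b, n\<close>; it reduces to that of \<open>a, b\<close> when \<open>n\<close> is a unit normal.\<close>

lemma det3_square:
  assumes "a \<bullet> n = 0" "b \<bullet> n = 0" "n \<bullet> n = 1"
  shows "(det3 a b n)\<^sup>2 = (a \<bullet> a) * (b \<bullet> b) - (a \<bullet> b)\<^sup>2"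
proof -
  have "(det3 a b n)\<^sup>2 = (a \<bullet> a) * ((b \<bullet> b) * (n \<bullet> n) - (b \<bullet> n)\<^sup>2)
      - (a \<bullet> b) * ((a \<bullet> b) * (n \<bullet> n) - (b \<bullet> n) * (a \<bullet> n)) + (a \<bullet> n) * ((a \<bullet> b) * (b \<bullet> n) - (b \<bullet> b) * (a \<bullet> n))"
    unfolding det3_expand inner_3 by algebra
  then show ?thesis using assms by (simp add: power2_eq_square)
qed

lemma det3_change_basis:
  "det3 (x *\<^sub>R a + y *\<^sub>R b) (z *\<^sub>R a + w *\<^sub>R b) n = (x * w - y * z) * det3 a b n"
  unfolding det3_expand by (simp add: algebra_simps)

lemma det3_scaleR: "det3 (x *\<^sub>R a) b c = x * det3 a b c" "det3 a (x *\<^sub>R b) c = x * det3 a b c"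
    "det3 a b (x *\<^sub>R c) = x * det3 a b c"
  unfolding det3_expand by (simp_all add: algebra_simps)

lemma det3_zero: "det3 0 b c = 0" "det3 a 0 c = 0" "det3 a b 0 = 0"
  unfolding det3_expand by simp_all

lemma smooth_on_det3:
  assumes "open S" "smooth_on S f" "smooth_on S g" "smooth_on S h"
  shows "smooth_on S (\<lambda>x. det3 (f x) (g x) (h x))"
proof -
  have "bounded_bilinear cross3"
    using bilinear_cross bilinear_conv_bounded_bilinear by blast
  then show ?thesis
    unfolding det3_eq_inner_cross
    by (intro smooth_on_inner[OF assms(1,2)] smooth_on_bilinear[OF assms(1) _ assms(3,4)])
qed

text \<open>The existence of a null vector, unlike the rank of a Jacobian matrix, transforms visibly under a
change of coordinates.\<close>

lemma sing_set_iff_null_vector: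
  assumes "q \<in> U" "f differentiable (at q)"
  shows "q \<in> sing_set U f \<longleftrightarrow> (\<exists>X. X \<noteq> 0 \<and> frechet_derivative f (at q) X = 0)"
proof -
  let ?A = "jacobian f (at q)"
  have "?A *v X = frechet_derivative f (at q) X" for X
    using fun_cong[OF frechet_derivative_at[OF iffD1[OF jacobian_works assms(2)]], of X] .
  moreover have "rank ?A < 2 \<longleftrightarrow> rank ?A \<noteq> CARD(2)"
    using rank_bound[of ?A] by auto
  ultimately show ?thesis
    using assms(1) matrix_nonfull_linear_equations_eq[of ?A] by (simp add: sing_set_def)
qed

section \<open>Frontals\<close>

lemma frontal_onD:
  assumes "frontal_on U f n"
  shows "open U" "smooth_on U f" "smooth_on U n"
    "q \<in> U \<Longrightarrow> n q \<bullet> n q = 1" "q \<in> U \<Longrightarrow> Du f q \<bullet> n q = 0" "q \<in> U \<Longrightarrow> Dv f q \<bullet> n q = 0"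
  using assms by (auto simp: frontal_on_def Du_def Dv_def dot_square_norm)

lemma frontal_onI:
  assumes "open U" "smooth_on U f" "smooth_on U n" "\<And>q. q \<in> U \<Longrightarrow> norm (n q) = 1"
    "\<And>q. q \<in> U \<Longrightarrow> Du f q \<bullet> n q = 0" "\<And>q. q \<in> U \<Longrightarrow> Dv f q \<bullet> n q = 0"
  shows "frontal_on U f n"
  using assms
  by (auto simp: frontal_on_def frechet_derivative_plane smooth_on_imp_differentiable inner_add_left)

lemma frontal_on_subset: "frontal_on U f n \<Longrightarrow> open T \<Longrightarrow> T \<subseteq> U \<Longrightarrow> frontal_on T f n"
  unfolding frontal_on_def by (meson smooth_on_subset subset_eq)

lemma D_inner_const:
  fixes f g :: "real^2 \<Rightarrow> real^3"
  assumes "open U" "smooth_on U f" "smooth_on U g" "\<And>x. x \<in> U \<Longrightarrow> f x \<bullet> g x = c" "q \<in> U"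
  shows "Du f q \<bullet> g q = - (f q \<bullet> Du g q)" "Dv f q \<bullet> g q = - (f q \<bullet> Dv g q)"
proof -
  have d: "f differentiable (at q)" "g differentiable (at q)"
    using assms smooth_on_imp_differentiable by blast+
  have "Du (\<lambda>x. c) q = Du (\<lambda>x. f x \<bullet> g x) q" "Dv (\<lambda>x. c) q = Dv (\<lambda>x. f x \<bullet> g x) q"
    by (rule Du_cong[OF assms(1,5)] Dv_cong[OF assms(1,5)]; simp add: assms(4))+
  then show "Du f q \<bullet> g q = - (f q \<bullet> Du g q)" "Dv f q \<bullet> g q = - (f q \<bullet> Dv g q)"
    using D_inner[OF d] by (simp_all add: D_const)
qed

text \<open>Both sides are minus the normal component of the mixed second derivative of \<open>f\<close>.\<close>

lemma frontal_second_form_symmetric: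
  assumes "frontal_on U f n" "q \<in> U"
  shows "Du f q \<bullet> Dv n q = Dv f q \<bullet> Du n q"
proof -
  note F = frontal_onD[OF assms(1)]
  have "Dv (Du f) q \<bullet> n q = - (Du f q \<bullet> Dv n q)"
    by (rule D_inner_const[OF F(1) smooth_on_Du[OF F(2)] F(3) F(5) assms(2)])
  moreover have "Du (Dv f) q \<bullet> n q = - (Dv f q \<bullet> Du n q)"
    by (rule D_inner_const[OF F(1) smooth_on_Dv[OF F(2)] F(3) F(6) assms(2)])
  ultimately show ?thesis
    using Du_Dv_commute[OF F(1) assms(2) F(2)] by simp
qed

lemma frontal_normal_derivative_orthogonal:
  assumes "frontal_on U f n" "q \<in> U"
  shows "n q \<bullet> Du n q = 0" "n q \<bullet> Dv n q = 0"
  using D_inner_const[OF frontal_onD(1,3,3)[OF assms(1)] frontal_onD(4)[OF assms(1)] assms(2)]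
  by (simp_all add: inner_commute)

text \<open>A change of coordinates with Jacobian \<open>J\<close> transforms both fundamental forms by the same congruence,
so the numerators and denominators of the two curvatures are all multiplied by \<open>J\<^sup>2\<close>.\<close>

lemma curvature_change_of_basis:
  assumes C: "Du C p = x *\<^sub>R Du c q + y *\<^sub>R Dv c q" "Dv C p = z *\<^sub>R Du c q + w *\<^sub>R Dv c q"
    and e: "Du e p = x *\<^sub>R Du n q + y *\<^sub>R Dv n q" "Dv e p = z *\<^sub>R Du n q + w *\<^sub>R Dv n q"
    and sym: "Du c q \<bullet> Dv n q = Dv c q \<bullet> Du n q" and D: "x * w - y * z \<noteq> 0"
  shows "gauss_curvature C e p = gauss_curvature c n q" "mean_curvature C e p = mean_curvature c n q"
proof -
  define D2 where "D2 = (x * w - y * z)\<^sup>2"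
  have D2: "D2 \<noteq> 0" using D by (simp add: D2_def)
  let ?E = "Du c q \<bullet> Du c q" and ?F = "Du c q \<bullet> Dv c q" and ?G = "Dv c q \<bullet> Dv c q"
    and ?L = "Du c q \<bullet> Du n q" and ?M = "Dv c q \<bullet> Du n q" and ?N = "Dv c q \<bullet> Dv n q"
  have E: "Du C p \<bullet> Du C p = x * x * ?E + 2 * x * y * ?F + y * y * ?G"
    and F: "Du C p \<bullet> Dv C p = x * z * ?E + (x * w + y * z) * ?F + y * w * ?G"
    and G: "Dv C p \<bullet> Dv C p = z * z * ?E + 2 * z * w * ?F + w * w * ?G"
    and L: "Du C p \<bullet> Du e p = x * x * ?L + 2 * x * y * ?M + y * y * ?N"
    and M: "Dv C p \<bullet> Du e p = x * z * ?L + (x * w + y * z) * ?M + y * w * ?N"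
    and N: "Dv C p \<bullet> Dv e p = z * z * ?L + 2 * z * w * ?M + w * w * ?N"
    unfolding C e by (simp_all add: inner_simps sym inner_commute[of "Dv c q" "Du c q"] algebra_simps)
  have 1: "(Du C p \<bullet> Du C p) * (Dv C p \<bullet> Dv C p) - (Du C p \<bullet> Dv C p)\<^sup>2 = D2 * (?E * ?G - ?F\<^sup>2)"
    and 2: "(- (Du C p \<bullet> Du e p)) * (- (Dv C p \<bullet> Dv e p)) - (- (Dv C p \<bullet> Du e p))\<^sup>2
      = D2 * ((- ?L) * (- ?N) - (- ?M)\<^sup>2)"
    and 3: "(Du C p \<bullet> Du C p) * (- (Dv C p \<bullet> Dv e p)) - 2 * (Du C p \<bullet> Dv C p) * (- (Dv C p \<bullet> Du e p))
       + (Dv C p \<bullet> Dv C p) * (- (Du C p \<bullet> Du e p))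
      = D2 * (?E * (- ?N) - 2 * ?F * (- ?M) + ?G * (- ?L))"
    unfolding E F G L M N D2_def by algebra+
  show "gauss_curvature C e p = gauss_curvature c n q"
    unfolding gauss_curvature_def Let_def 1 2 using D2 by simp
  have "2 * (D2 * (?E * ?G - ?F\<^sup>2)) = D2 * (2 * (?E * ?G - ?F\<^sup>2))" by simp
  then show "mean_curvature C e p = mean_curvature c n q"
    unfolding mean_curvature_def Let_def 1 3 using D2 by simp
qed

section \<open>Normal form near a pure-frontal singular point\<close>

text \<open>These conditions say that in the given coordinates the \<open>u\<close>-axis consists of pure-frontal singular
points with null direction \<open>(0, 1)\<close>: there both \<open>c\<close> and its normal have vanishing \<open>v\<close>-derivative, and
after division by \<open>v\<close> the frame \<open>Du c, Dv c / v, n\<close> stays non-degenerate across the axis. Given the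
other conditions, \<open>Dv n = 0\<close> on the axis is equivalent to the vanishing of \<open>psi\<close>, because \<open>Dv n\<close>
is then orthogonal to \<open>Du c\<close> and \<open>n\<close>.\<close>

definition pure_frontal_chart :: "real \<Rightarrow> (real^2 \<Rightarrow> real^3) \<Rightarrow> (real^2 \<Rightarrow> real^3) \<Rightarrow> bool" where
  "pure_frontal_chart s c n \<longleftrightarrow> 0 < s \<and> frontal_on (ball 0 s) c n \<and>
    (\<forall>q\<in>ball 0 s. q $ 2 = 0 \<longrightarrow> Dv c q = 0 \<and> Dv n q = 0) \<and>
    (\<forall>q\<in>ball 0 s. det3 (Du c q) (Dv_over_v c q) (n q) \<noteq> 0)"

lemma isCont_imp_bounded_near:
  fixes f :: "'a::metric_space \<Rightarrow> real"
  assumes "isCont f p"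
  shows "\<exists>s>0. \<forall>q\<in>ball p s. \<bar>f q\<bar> \<le> \<bar>f p\<bar> + 1"
proof -
  obtain s where "s > 0" "\<forall>q. dist q p < s \<longrightarrow> dist (f q) (f p) < 1"
    using assms unfolding continuous_at_eps_delta by (metis zero_less_one)
  then show ?thesis
    by (intro exI[of _ s]) (auto simp: dist_real_def dist_commute abs_real_def split: if_splits, force+)
qed

text \<open>With \<open>Dv c = v k\<close> and \<open>Dv n = v l\<close>, the numerator and the denominator of each curvature are divisible
by \<open>v\<^sup>2\<close>. After cancellation the denominator is a squared determinant that does not vanish on the
axis, so both curvatures extend continuously.\<close>

lemma pure_frontal_chart_curvatures_bounded:
  assumes "pure_frontal_chart s c n"
  shows "\<exists>s' B. 0 < s' \<and> s' \<le> s \<and> (\<forall>q\<in>ball 0 s'. q $ 2 \<noteq> 0 \<longrightarrow>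
    \<bar>gauss_curvature c n q\<bar> \<le> B \<and> \<bar>mean_curvature c n q\<bar> \<le> B)"
proof -
  have s: "0 < s" and fr: "frontal_on (ball 0 s) c n"
    and ax: "\<And>q. q \<in> ball 0 s \<Longrightarrow> q $ 2 = 0 \<Longrightarrow> Dv c q = 0" "\<And>q. q \<in> ball 0 s \<Longrightarrow> q $ 2 = 0 \<Longrightarrow> Dv n q = 0"
    and det: "\<And>q. q \<in> ball 0 s \<Longrightarrow> det3 (Du c q) (Dv_over_v c q) (n q) \<noteq> 0"
    using assms by (auto simp: pure_frontal_chart_def)
  note F = frontal_onD[OF fr]
  define k l where "k = Dv_over_v c" and "l = Dv_over_v n"
  have sk: "smooth_on (ball 0 s) k" and sl: "smooth_on (ball 0 s) l"
    unfolding k_def l_def using smooth_on_Dv_over_v F ax by blast+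
  define K where "K q = ((- (Du c q \<bullet> Du n q)) * (- (k q \<bullet> l q)) - (- (k q \<bullet> Du n q))\<^sup>2)
     / ((Du c q \<bullet> Du c q) * (k q \<bullet> k q) - (Du c q \<bullet> k q)\<^sup>2)" for q
  define H where "H q = ((Du c q \<bullet> Du c q) * (- (k q \<bullet> l q)) - 2 * (Du c q \<bullet> k q) * (- (k q \<bullet> Du n q))
     + (k q \<bullet> k q) * (- (Du c q \<bullet> Du n q)))
     / (2 * ((Du c q \<bullet> Du c q) * (k q \<bullet> k q) - (Du c q \<bullet> k q)\<^sup>2))" for q
  have kn: "k q \<bullet> n q = 0" if "q \<in> ball 0 s" for q
  proof (rule zero_off_axis_imp_zero[OF open_ball _ _ that])
    show "continuous_on (ball 0 s) (\<lambda>q. k q \<bullet> n q)"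
      by (intro continuous_on_inner smooth_on_imp_continuous_on sk F)
    show "k x \<bullet> n x = 0" if "x \<in> ball 0 s" "x $ 2 \<noteq> 0" for x
      using that F(6)[of x] by (simp add: k_def Dv_over_v_def)
  qed
  have den: "(Du c q \<bullet> Du c q) * (k q \<bullet> k q) - (Du c q \<bullet> k q)\<^sup>2 \<noteq> 0" if "q \<in> ball 0 s" for q
    using det[OF that] det3_square[OF F(5)[OF that] kn[OF that] F(4)[OF that]] by (auto simp: k_def)
  have 0: "(0::real^2) \<in> ball 0 s" using s by simp
  have C: "isCont f 0" if "smooth_on (ball 0 s) f" for f :: "real^2 \<Rightarrow> real^3"
    using smooth_on_imp_continuous_on[OF that] 0 continuous_on_eq_continuous_at open_ball by blast
  have cont: "isCont (Du c) 0" "isCont (Du n) 0" "isCont k 0" "isCont l 0"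
    by (rule C; intro sk sl smooth_on_Du F)+
  have "isCont K 0" "isCont H 0"
    unfolding K_def[abs_def] H_def[abs_def] using den[OF 0]
    by (intro continuous_intros cont; simp)+
  from isCont_imp_bounded_near[OF this(1)] isCont_imp_bounded_near[OF this(2)]
  obtain s1 s2 where s1: "s1 > 0" "\<forall>q\<in>ball 0 s1. \<bar>K q\<bar> \<le> \<bar>K 0\<bar> + 1"
      and s2: "s2 > 0" "\<forall>q\<in>ball 0 s2. \<bar>H q\<bar> \<le> \<bar>H 0\<bar> + 1" by blast
  have eq: "gauss_curvature c n q = K q" "mean_curvature c n q = H q"
    if q: "q \<in> ball 0 s" "q $ 2 \<noteq> 0" for q
  proof -
    define v2 where "v2 = (q $ 2)\<^sup>2"
    have v2: "v2 \<noteq> 0" using q by (simp add: v2_def)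
    have cv: "Dv c q = q $ 2 *\<^sub>R k q" "Dv n q = q $ 2 *\<^sub>R l q"
      using q(2) by (simp_all add: k_def l_def Dv_over_v_def)
    let ?E = "Du c q \<bullet> Du c q" and ?F = "Du c q \<bullet> k q" and ?G = "k q \<bullet> k q"
      and ?L = "Du c q \<bullet> Du n q" and ?M = "k q \<bullet> Du n q" and ?N = "k q \<bullet> l q"
    have 1: "?E * (Dv c q \<bullet> Dv c q) - (Du c q \<bullet> Dv c q)\<^sup>2 = v2 * (?E * ?G - ?F\<^sup>2)"
      and 2: "(- ?L) * (- (Dv c q \<bullet> Dv n q)) - (- (Dv c q \<bullet> Du n q))\<^sup>2 = v2 * ((- ?L) * (- ?N) - (- ?M)\<^sup>2)"
      and 3: "?E * (- (Dv c q \<bullet> Dv n q)) - 2 * (Du c q \<bullet> Dv c q) * (- (Dv c q \<bullet> Du n q))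
          + (Dv c q \<bullet> Dv c q) * (- ?L) = v2 * (?E * (- ?N) - 2 * ?F * (- ?M) + ?G * (- ?L))"
      unfolding cv v2_def by (simp_all add: algebra_simps power2_eq_square)
    show "gauss_curvature c n q = K q"
      unfolding gauss_curvature_def Let_def 1 2 K_def using v2 by simp
    have "2 * (v2 * (?E * ?G - ?F\<^sup>2)) = v2 * (2 * (?E * ?G - ?F\<^sup>2))" by simp
    then show "mean_curvature c n q = H q"
      unfolding mean_curvature_def Let_def 1 3 H_def using v2 by simp
  qed
  have "\<bar>gauss_curvature c n q\<bar> \<le> \<bar>K 0\<bar> + \<bar>H 0\<bar> + 1 \<and> \<bar>mean_curvature c n q\<bar> \<le> \<bar>K 0\<bar> + \<bar>H 0\<bar> + 1"
    if "q \<in> ball 0 (min s (min s1 s2))" "q $ 2 \<noteq> 0" for q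
  proof -
    have "q \<in> ball 0 s" "\<bar>K q\<bar> \<le> \<bar>K 0\<bar> + 1" "\<bar>H q\<bar> \<le> \<bar>H 0\<bar> + 1"
      using that(1) s1(2) s2(2) by auto
    then show ?thesis using eq[OF _ that(2)] by auto
  qed
  moreover have "0 < min s (min s1 s2)" "min s (min s1 s2) \<le> s" using s s1(1) s2(1) by auto
  ultimately show ?thesis by blast
qed

section \<open>Changes of coordinates\<close>

lemma curve_chain:
  assumes "(\<gamma> has_vector_derivative g') (at t)" "(f has_derivative F) (at (\<gamma> t))"
  shows "((\<lambda>s. f (\<gamma> s)) has_vector_derivative F g') (at t)"
proof -
  have "((\<lambda>s. f (\<gamma> s)) has_derivative (\<lambda>s. F (s *\<^sub>R g'))) (at t)"
    using has_derivative_compose[OF assms(1)[unfolded has_vector_derivative_def] assms(2)] .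
  then show ?thesis
    using has_derivative_linear[OF assms(2)] by (simp add: has_vector_derivative_def linear_scale)
qed

lemma smooth_curve_derivative:
  assumes "smooth_on {-\<epsilon><..<\<epsilon>} \<gamma>" "t \<in> {-\<epsilon><..<\<epsilon>}"
  shows "(\<gamma> has_vector_derivative vector_derivative \<gamma> (at t)) (at t)"
  using smooth_on_imp_differentiable[OF assms] vector_derivative_works by blast

text \<open>The coordinates \<open>(u, v)\<close> run through \<open>V\<close>; \<open>\<Phi>\<close> maps them to the original coordinates and \<open>\<Psi>\<close> is its
inverse on \<open>\<Phi> ` V\<close>.\<close>

locale chart =
  fixes U V :: "(real^2) set" and \<Phi> \<Psi> :: "real^2 \<Rightarrow> real^2"
  assumes change: "coordinate_change U V \<Phi> \<Psi>"
begin

lemma chart_basic: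
  "open V" "0 \<in> V" "\<Phi> 0 = 0" "open (\<Phi> ` V)" "\<Phi> ` V \<subseteq> U" "smooth_on V \<Phi>" "smooth_on (\<Phi> ` V) \<Psi>"
  "q \<in> V \<Longrightarrow> \<Psi> (\<Phi> q) = q" "p \<in> \<Phi> ` V \<Longrightarrow> \<Phi> (\<Psi> p) = p" "p \<in> \<Phi> ` V \<Longrightarrow> \<Psi> p \<in> V"
  using change by (auto simp: coordinate_change_def)

lemma open_image: 
  assumes "open T" "T \<subseteq> V" shows "open (\<Phi> ` T)"
proof -
  have "open (\<Phi> ` V \<inter> \<Psi> -` T)"
    using continuous_on_open_vimage[OF chart_basic(4)] assms(1) chart_basic(7)
    by (metis Int_commute smooth_on_imp_continuous_on)
  moreover have "\<Phi> ` V \<inter> \<Psi> -` T = \<Phi> ` T"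
    using assms(2) chart_basic(8) by force
  ultimately show ?thesis by simp
qed

abbreviation "D\<Phi> q \<equiv> frechet_derivative \<Phi> (at q)"
abbreviation "D\<Psi> p \<equiv> frechet_derivative \<Psi> (at p)"

lemma der_\<Phi>: "q \<in> V \<Longrightarrow> (\<Phi> has_derivative D\<Phi> q) (at q)"
  and der_\<Psi>: "p \<in> \<Phi> ` V \<Longrightarrow> (\<Psi> has_derivative D\<Psi> p) (at p)"
  using smooth_on_imp_has_derivative chart_basic(6,7) by blast+

lemma linear_D: "q \<in> V \<Longrightarrow> linear (D\<Phi> q)" "p \<in> \<Phi> ` V \<Longrightarrow> linear (D\<Psi> p)"
  using der_\<Phi> der_\<Psi> has_derivative_linear by blast+

lemma D_inverse:
  assumes "p \<in> \<Phi> ` V"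
  shows "D\<Psi> p (D\<Phi> (\<Psi> p) X) = X" "D\<Phi> (\<Psi> p) (D\<Psi> p X) = X"
proof -
  have \<Psi>p: "\<Psi> p \<in> V" "\<Phi> (\<Psi> p) = p" using assms chart_basic by blast+
  have "((\<lambda>x. \<Psi> (\<Phi> x)) has_derivative (\<lambda>X. D\<Psi> p (D\<Phi> (\<Psi> p) X))) (at (\<Psi> p))"
    using has_derivative_compose[OF der_\<Phi>[OF \<Psi>p(1)]] der_\<Psi>[OF assms] \<Psi>p by simp
  then have "((\<lambda>x. x) has_derivative (\<lambda>X. D\<Psi> p (D\<Phi> (\<Psi> p) X))) (at (\<Psi> p))"
    by (rule has_derivative_transform_within_open[OF _ chart_basic(1) \<Psi>p(1)]) (simp add: chart_basic)
  from has_derivative_unique[OF this has_derivative_ident] show "D\<Psi> p (D\<Phi> (\<Psi> p) X) = X"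
    by meson
  have "((\<lambda>x. \<Phi> (\<Psi> x)) has_derivative (\<lambda>X. D\<Phi> (\<Psi> p) (D\<Psi> p X))) (at p)"
    using has_derivative_compose[OF der_\<Psi>[OF assms] der_\<Phi>[OF \<Psi>p(1)]] .
  then have "((\<lambda>x. x) has_derivative (\<lambda>X. D\<Phi> (\<Psi> p) (D\<Psi> p X))) (at p)"
    by (rule has_derivative_transform_within_open[OF _ chart_basic(4) assms]) (simp add: chart_basic)
  from has_derivative_unique[OF this has_derivative_ident] show "D\<Phi> (\<Psi> p) (D\<Psi> p X) = X"
    by meson
qed

lemma D_inverse':
  assumes "q \<in> V"
  shows "D\<Psi> (\<Phi> q) (D\<Phi> q X) = X" "D\<Phi> q (D\<Psi> (\<Phi> q) X) = X"
  using D_inverse[of "\<Phi> q"] assms chart_basic(8) by auto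

lemma D_nonzero: "q \<in> V \<Longrightarrow> X \<noteq> 0 \<Longrightarrow> D\<Phi> q X \<noteq> 0" "p \<in> \<Phi> ` V \<Longrightarrow> X \<noteq> 0 \<Longrightarrow> D\<Psi> p X \<noteq> 0"
  using D_inverse' D_inverse linear_0 linear_D chart_basic(10) by metis+

lemma pullback:
  assumes "smooth_on U h"
  shows "smooth_on V (h \<circ> \<Phi>)"
    "q \<in> V \<Longrightarrow> frechet_derivative (h \<circ> \<Phi>) (at q) X = frechet_derivative h (at (\<Phi> q)) (D\<Phi> q X)"
proof -
  have sm: "smooth_on (\<Phi> ` V) h" using assms chart_basic smooth_on_subset by blast
  then show "smooth_on V (h \<circ> \<Phi>)"
    unfolding o_def by (intro smooth_on_compose[OF chart_basic(1) chart_basic(4) order_refl _ chart_basic(6)])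
  assume q: "q \<in> V"
  then have "((h \<circ> \<Phi>) has_derivative frechet_derivative h (at (\<Phi> q)) \<circ> D\<Phi> q) (at q)"
    by (intro diff_chain_at der_\<Phi> smooth_on_imp_has_derivative[OF sm]) auto
  from frechet_derivative_at[OF this] show "frechet_derivative (h \<circ> \<Phi>) (at q) X = frechet_derivative h (at (\<Phi> q)) (D\<Phi> q X)"
    by (metis comp_apply)
qed

lemma pushforward:
  assumes "open T" "T \<subseteq> V" "smooth_on T h"
  shows "smooth_on (\<Phi> ` T) (h \<circ> \<Psi>)"
    "p \<in> \<Phi> ` T \<Longrightarrow> frechet_derivative (h \<circ> \<Psi>) (at p) X = frechet_derivative h (at (\<Psi> p)) (D\<Psi> p X)"
proof -
  have sub: "\<Phi> ` T \<subseteq> \<Phi> ` V" and im: "\<Psi> ` \<Phi> ` T \<subseteq> T"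
    using assms(2) chart_basic(8) by auto
  show "smooth_on (\<Phi> ` T) (h \<circ> \<Psi>)"
    unfolding o_def
    by (intro smooth_on_compose[OF open_image[OF assms(1,2)] assms(1) im assms(3)]
        smooth_on_subset[OF chart_basic(7) sub])
  assume p: "p \<in> \<Phi> ` T"
  then have "((h \<circ> \<Psi>) has_derivative frechet_derivative h (at (\<Psi> p)) \<circ> D\<Psi> p) (at p)"
    using sub im by (intro diff_chain_at der_\<Psi> smooth_on_imp_has_derivative[OF assms(3)]) auto
  from frechet_derivative_at[OF this] show "frechet_derivative (h \<circ> \<Psi>) (at p) X = frechet_derivative h (at (\<Psi> p)) (D\<Psi> p X)"
    by (metis comp_apply)
qed

lemma sing_set_pullback:
  assumes "smooth_on U h" "q \<in> V"
  shows "q \<in> sing_set V (h \<circ> \<Phi>) \<longleftrightarrow> \<Phi> q \<in> sing_set U h"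
proof -
  have U: "\<Phi> q \<in> U" using assms(2) chart_basic by blast
  have 1: "q \<in> sing_set V (h \<circ> \<Phi>) \<longleftrightarrow> (\<exists>X. X \<noteq> 0 \<and> frechet_derivative h (at (\<Phi> q)) (D\<Phi> q X) = 0)"
    using sing_set_iff_null_vector[OF assms(2) smooth_on_imp_differentiable[OF pullback(1)[OF assms(1)] assms(2)]]
      pullback(2)[OF assms] by simp
  have 2: "\<Phi> q \<in> sing_set U h \<longleftrightarrow> (\<exists>Y. Y \<noteq> 0 \<and> frechet_derivative h (at (\<Phi> q)) Y = 0)"
    by (rule sing_set_iff_null_vector[OF U smooth_on_imp_differentiable[OF assms(1) U]])
  show ?thesis
    unfolding 1 2
    using D_inverse'[OF assms(2)] D_nonzero(1)[OF assms(2)] D_nonzero(2)[of "\<Phi> q"] assms(2) by (metis imageI)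
qed

lemma chart_jacobian_nonzero:
  assumes "p \<in> \<Phi> ` V"
  shows "Du \<Psi> p $ 1 * Dv \<Psi> p $ 2 - Du \<Psi> p $ 2 * Dv \<Psi> p $ 1 \<noteq> 0"
proof -
  have *: "D\<Psi> p X = X $ 1 *\<^sub>R Du \<Psi> p + X $ 2 *\<^sub>R Dv \<Psi> p" for X
    using der_\<Psi>[OF assms] frechet_derivative_plane differentiableI by blast
  define A B where "A = D\<Phi> (\<Psi> p) (axis 1 1)" and "B = D\<Phi> (\<Psi> p) (axis 2 1)"
  have "A $ 1 *\<^sub>R Du \<Psi> p + A $ 2 *\<^sub>R Dv \<Psi> p = axis 1 1"
    and "B $ 1 *\<^sub>R Du \<Psi> p + B $ 2 *\<^sub>R Dv \<Psi> p = axis 2 1"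
    using D_inverse(1)[OF assms] * unfolding A_def B_def by metis+
  then have "A $ 1 * Du \<Psi> p $ 1 + A $ 2 * Dv \<Psi> p $ 1 = 1" "A $ 1 * Du \<Psi> p $ 2 + A $ 2 * Dv \<Psi> p $ 2 = 0"
    "B $ 1 * Du \<Psi> p $ 1 + B $ 2 * Dv \<Psi> p $ 1 = 0" "B $ 1 * Du \<Psi> p $ 2 + B $ 2 * Dv \<Psi> p $ 2 = 1"
    by (simp_all add: vec_eq_iff forall_2)
  then have "(A $ 1 * B $ 2 - A $ 2 * B $ 1) * (Du \<Psi> p $ 1 * Dv \<Psi> p $ 2 - Du \<Psi> p $ 2 * Dv \<Psi> p $ 1) = 1"
    by algebra
  then show ?thesis by auto
qed

lemma singular_curve_in_axis:
  assumes sm: "smooth_on U f" and ax: "sing_set V (f \<circ> \<Phi>) = {q \<in> V. q $ 2 = 0}"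
    and \<gamma>: "singular_curve U f p \<epsilon> \<gamma>" and t: "t \<in> {-\<epsilon><..<\<epsilon>}" "\<gamma> t \<in> \<Phi> ` V"
  shows "\<Psi> (\<gamma> t) $ 2 = 0"
proof -
  have "\<gamma> t \<in> sing_set U f" using \<gamma> t(1) unfolding singular_curve_def by blast
  then show ?thesis
    using sing_set_pullback[OF sm chart_basic(10)[OF t(2)]] ax chart_basic(9)[OF t(2)] by auto
qed

text \<open>Along the axis, \<open>Dv m\<close> is orthogonal to \<open>m\<close> because \<open>m\<close> is a unit field, and to \<open>Du g\<close> because the
second fundamental form is symmetric and \<open>Dv g = 0\<close>. The function \<open>psi\<close> of the given curve and null
field is, up to a nonzero factor, the determinant of \<open>Du g, m, Dv m\<close>: the velocity of the curve
corresponds to a nonzero multiple of the \<open>u\<close>-direction and the null field to one of the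
\<open>v\<close>-direction. So its vanishing removes the last component of \<open>Dv m\<close>.\<close>

lemma pure_frontal_imp_normal_derivative_zero:
  assumes fr: "frontal_on U f \<nu>" and pf: "pure_frontal_point U f \<nu> 0" and ad: "adapted V (f \<circ> \<Phi>) (\<nu> \<circ> \<Phi>)"
  shows "\<exists>r>0. ball 0 r \<subseteq> V \<and> (\<forall>q\<in>ball 0 r. q $ 2 = 0 \<longrightarrow> Dv (\<nu> \<circ> \<Phi>) q = 0)"
proof -
  let ?g = "f \<circ> \<Phi>" and ?m = "\<nu> \<circ> \<Phi>"
  note F = frontal_onD[OF fr]
  have ax: "sing_set V ?g = {q \<in> V. q $ 2 = 0}" using ad by (simp add: adapted_def)
  obtain \<epsilon> \<gamma> \<eta> where fk: "first_kind_via U f \<nu> 0 \<epsilon> \<gamma> \<eta>" and psi: "\<And>t. t \<in> {-\<epsilon><..<\<epsilon>} \<Longrightarrow> psi f \<nu> \<gamma> \<eta> t = 0"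
    using pf unfolding pure_frontal_point_def by blast
  then have \<gamma>: "singular_curve U f 0 \<epsilon> \<gamma>" and \<eta>: "null_field f (\<gamma> ` {-\<epsilon><..<\<epsilon>}) \<eta>"
    by (simp_all add: first_kind_via_def)
  then obtain W where W: "open W" "0 \<in> W" "\<gamma> ` {-\<epsilon><..<\<epsilon>} = sing_set U f \<inter> W" and \<gamma>s: "smooth_on {-\<epsilon><..<\<epsilon>} \<gamma>"
    and \<gamma>0: "\<And>t. t \<in> {-\<epsilon><..<\<epsilon>} \<Longrightarrow> vector_derivative \<gamma> (at t) \<noteq> 0"
    unfolding singular_curve_def by blast
  have "open (V \<inter> \<Phi> -` W)"
    using continuous_on_open_vimage[OF chart_basic(1)] W(1) smooth_on_imp_continuous_on[OF chart_basic(6)]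
    by (metis Int_commute)
  moreover have "0 \<in> V \<inter> \<Phi> -` W" using chart_basic(2,3) W(2) by simp
  ultimately obtain r where r: "r > 0" "ball 0 r \<subseteq> V \<inter> \<Phi> -` W"
    using open_contains_ball by meson
  have "Dv ?m q = 0" if q: "q \<in> ball 0 r" "q $ 2 = 0" for q
  proof -
    have qV: "q \<in> V" and pV: "\<Phi> q \<in> \<Phi> ` V" using q r by auto
    have pU: "\<Phi> q \<in> U" using pV chart_basic(5) by blast
    have "\<Phi> q \<in> sing_set U f \<inter> W"
      using sing_set_pullback[OF F(2) qV] ax q r(2) qV by auto
    then obtain t where t: "t \<in> {-\<epsilon><..<\<epsilon>}" "\<gamma> t = \<Phi> q" using W(3) by (metis imageE)
    define \<gamma>' where "\<gamma>' = vector_derivative \<gamma> (at t)"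
    have d\<gamma>: "(\<gamma> has_vector_derivative \<gamma>') (at t)"
      unfolding \<gamma>'_def by (rule smooth_curve_derivative[OF \<gamma>s t(1)])
    \<comment> \<open>The velocity of the curve and, below, the null vector in adapted coordinates.\<close>
    define Z where "Z = D\<Psi> (\<Phi> q) \<gamma>'"
    have Z: "Z \<noteq> 0" "D\<Phi> q Z = \<gamma>'"
      unfolding Z_def using D_nonzero(2)[OF pV] \<gamma>0[OF t(1)] D_inverse'[OF qV] by (auto simp: \<gamma>'_def)
    have "Z $ 2 = 0"
    proof -
      have "((\<lambda>s. \<Psi> (\<gamma> s) $ 2) has_vector_derivative Z $ 2) (at t)"
        unfolding Z_def using der_\<Psi>[OF pV]
        by (intro curve_chain[OF d\<gamma>] bounded_linear.has_derivative[OF bounded_linear_vec_nth]) (simp add: t(2))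
      moreover have "((\<lambda>s. \<Psi> (\<gamma> s) $ 2) has_vector_derivative 0) (at t)"
      proof (rule has_vector_derivative_transform_within_open[where f = "\<lambda>s. 0"])
        show "open ({-\<epsilon><..<\<epsilon>} \<inter> \<gamma> -` (\<Phi> ` V))"
          using continuous_on_open_vimage[OF open_greaterThanLessThan] chart_basic(4)
            smooth_on_imp_continuous_on[OF \<gamma>s] by (metis Int_commute)
        show "t \<in> {-\<epsilon><..<\<epsilon>} \<inter> \<gamma> -` (\<Phi> ` V)" using t pV by auto
        show "0 = \<Psi> (\<gamma> s) $ 2" if "s \<in> {-\<epsilon><..<\<epsilon>} \<inter> \<gamma> -` (\<Phi> ` V)" for s
          using singular_curve_in_axis[OF F(2) ax \<gamma>, of s] that by auto
      qed simp
      ultimately show ?thesis using vector_derivative_unique_at by blast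
    qed
    then have Z1: "Z $ 1 \<noteq> 0" using Z(1) plane_eqI[of Z 0] by auto
    have adq: "Dv ?g q = 0" "norm (Du ?g q) = 1" "norm (?m q) = 1" "Du ?g q \<bullet> ?m q = 0"
      using ad qV q(2) by (auto simp: adapted_def)
    note sg = pullback[OF F(2)] and sm = pullback[OF F(3)]
    have Dg: "frechet_derivative f (at (\<Phi> q)) (D\<Phi> q X) = X $ 1 *\<^sub>R Du ?g q" for X
      using sg(2)[OF qV, of X] frechet_derivative_plane[OF smooth_on_imp_differentiable[OF sg(1) qV], of X] adq(1) by simp
    define Y where "Y = D\<Psi> (\<Phi> q) (\<eta> (\<gamma> t))"
    have "\<eta> (\<Phi> q) \<noteq> 0" and "frechet_derivative f (at (\<Phi> q)) (\<eta> (\<Phi> q)) = 0"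
      using \<eta> t unfolding null_field_def by (metis imageI subsetD)+
    then have Y: "Y \<noteq> 0" "D\<Phi> q Y = \<eta> (\<Phi> q)" and "frechet_derivative f (at (\<Phi> q)) (D\<Phi> q Y) = 0"
      unfolding Y_def t(2) using D_nonzero(2)[OF pV] D_inverse'[OF qV] by auto
    then have "Y $ 1 *\<^sub>R Du ?g q = 0" using Dg by metis
    then have "Y $ 1 = 0" using adq(2) by auto
    then have Y2: "Y $ 2 \<noteq> 0" using Y(1) plane_eqI[of Y 0] by auto
    have "((\<lambda>s. f (\<gamma> s)) has_vector_derivative frechet_derivative f (at (\<Phi> q)) \<gamma>') (at t)"
      by (rule curve_chain[OF d\<gamma>]) (use t(2) smooth_on_imp_has_derivative[OF F(2) pU] in simp)
    then have 1: "vector_derivative (f \<circ> \<gamma>) (at t) = Z $ 1 *\<^sub>R Du ?g q"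
      using Dg[of Z] Z(2) by (simp add: o_def vector_derivative_at)
    have 2: "frechet_derivative \<nu> (at (\<Phi> q)) (\<eta> (\<Phi> q)) = Y $ 2 *\<^sub>R Dv ?m q"
      using sm(2)[OF qV, of Y] frechet_derivative_plane[OF smooth_on_imp_differentiable[OF sm(1) qV], of Y]
        Y(2) \<open>Y $ 1 = 0\<close> by simp
    have "det3 (Z $ 1 *\<^sub>R Du ?g q) (?m q) (Y $ 2 *\<^sub>R Dv ?m q) = 0"
      using psi[OF t(1)] 1 2 by (simp add: psi_def t(2))
    then have det: "det3 (Du ?g q) (?m q) (Dv ?m q) = 0"
      using Z1 Y2 by (simp add: det3_scaleR)
    have frg: "frontal_on V ?g ?m"
      using F(4) chart_basic(1,5) sg sm fr by (auto simp: frontal_on_def)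
    have "Du ?g q \<bullet> Dv ?m q = 0" "?m q \<bullet> Dv ?m q = 0"
      using frontal_second_form_symmetric[OF frg qV] frontal_normal_derivative_orthogonal[OF frg qV] adq(1) by auto
    moreover have "Du ?g q \<bullet> Du ?g q = 1" "?m q \<bullet> ?m q = 1" using adq by (simp_all add: norm_eq_1)
    \<comment> \<open>The Gram determinant, expanded along the last vector.\<close>
    moreover have "(det3 (Du ?g q) (?m q) (Dv ?m q))\<^sup>2 =
       (Dv ?m q \<bullet> Dv ?m q) * ((Du ?g q \<bullet> Du ?g q) * (?m q \<bullet> ?m q) - (Du ?g q \<bullet> ?m q)\<^sup>2)
       - (?m q \<bullet> Dv ?m q) * ((?m q \<bullet> Dv ?m q) * (Du ?g q \<bullet> Du ?g q) - (Du ?g q \<bullet> ?m q) * (Du ?g q \<bullet> Dv ?m q))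
       + (Du ?g q \<bullet> Dv ?m q) * ((Du ?g q \<bullet> ?m q) * (?m q \<bullet> Dv ?m q) - (Du ?g q \<bullet> Dv ?m q) * (?m q \<bullet> ?m q))"
      unfolding det3_expand inner_3 by algebra
    ultimately show ?thesis using adq(4) det by simp
  qed
  then show ?thesis using r by blast
qed

end

section \<open>Carrying a normal form to other coordinates\<close>

lemma pure_frontal_chart_null_vector:
  assumes "pure_frontal_chart s c n" "q \<in> ball 0 s"
  shows "(\<exists>X. X \<noteq> 0 \<and> frechet_derivative c (at q) X = 0) \<longleftrightarrow> q $ 2 = 0"
proof -
  have fr: "frontal_on (ball 0 s) c n"
    and ax: "q $ 2 = 0 \<Longrightarrow> Dv c q = 0"
    and det: "det3 (Du c q) (Dv_over_v c q) (n q) \<noteq> 0"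
    using assms by (auto simp: pure_frontal_chart_def)
  have D: "frechet_derivative c (at q) X = X $ 1 *\<^sub>R Du c q + (X $ 2 * q $ 2) *\<^sub>R Dv_over_v c q" for X
    using frechet_derivative_plane[OF smooth_on_imp_differentiable[OF frontal_onD(2)[OF fr] assms(2)]]
      Dv_eq_Dv_over_v[of q c, OF ax] by simp
  show ?thesis
  proof
    assume "\<exists>X. X \<noteq> 0 \<and> frechet_derivative c (at q) X = 0"
    then obtain X :: "real^2" where X: "X \<noteq> 0" "X $ 1 *\<^sub>R Du c q + (X $ 2 * q $ 2) *\<^sub>R Dv_over_v c q = 0"
      using D by auto
    have "det3 (X $ 1 *\<^sub>R Du c q + (X $ 2 * q $ 2) *\<^sub>R Dv_over_v c q) (0 *\<^sub>R Du c q + 1 *\<^sub>R Dv_over_v c q) (n q) = 0"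
      "det3 (1 *\<^sub>R Du c q + 0 *\<^sub>R Dv_over_v c q) (X $ 1 *\<^sub>R Du c q + (X $ 2 * q $ 2) *\<^sub>R Dv_over_v c q) (n q) = 0"
      unfolding X(2) by (simp_all add: det3_zero)
    then have "X $ 1 = 0" "X $ 2 * q $ 2 = 0"
      unfolding det3_change_basis using det by auto
    then show "q $ 2 = 0" using X(1) plane_eqI[of X 0] by auto
  next
    assume "q $ 2 = 0"
    then have "frechet_derivative c (at q) (axis 2 1) = 0" using D[of "axis 2 1"] by simp
    moreover have "axis 2 (1::real) \<noteq> (0 :: real^2)" by (simp add: axis_eq_0_iff)
    ultimately show "\<exists>X. X \<noteq> 0 \<and> frechet_derivative c (at q) X = 0" by blast
  qed
qed

context chart
begin

lemma ball_subset_image: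
  assumes "ball 0 s \<subseteq> V" "0 < s"
  shows "open (\<Phi> ` ball 0 s)" "0 \<in> \<Phi> ` ball 0 s" "\<Phi> ` ball 0 s \<subseteq> \<Phi> ` V"
    "p \<in> \<Phi> ` ball 0 s \<longleftrightarrow> p \<in> \<Phi> ` V \<and> \<Psi> p \<in> ball 0 s"
proof -
  show "open (\<Phi> ` ball 0 s)" by (rule open_image[OF open_ball assms(1)])
  show "0 \<in> \<Phi> ` ball 0 s"
    using assms(2) chart_basic(3) by (intro image_eqI[of _ _ 0]) simp_all
  show "\<Phi> ` ball 0 s \<subseteq> \<Phi> ` V" using assms(1) by blast
  show "p \<in> \<Phi> ` ball 0 s \<longleftrightarrow> p \<in> \<Phi> ` V \<and> \<Psi> p \<in> ball 0 s"
  proof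
    assume "p \<in> \<Phi> ` ball 0 s"
    then obtain q where "q \<in> ball 0 s" "p = \<Phi> q" by blast
    then show "p \<in> \<Phi> ` V \<and> \<Psi> p \<in> ball 0 s" using assms(1) chart_basic(8)[of q] by auto
  next
    assume "p \<in> \<Phi> ` V \<and> \<Psi> p \<in> ball 0 s"
    then show "p \<in> \<Phi> ` ball 0 s" using chart_basic(9)[of p] by (intro image_eqI[of _ _ "\<Psi> p"]) simp_all
  qed
qed

lemma image_partials:
  assumes "open T" "T \<subseteq> V" "smooth_on T h" "p \<in> \<Phi> ` T"
  shows "Du (h \<circ> \<Psi>) p = Du \<Psi> p $ 1 *\<^sub>R Du h (\<Psi> p) + Du \<Psi> p $ 2 *\<^sub>R Dv h (\<Psi> p)"
    "Dv (h \<circ> \<Psi>) p = Dv \<Psi> p $ 1 *\<^sub>R Du h (\<Psi> p) + Dv \<Psi> p $ 2 *\<^sub>R Dv h (\<Psi> p)"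
proof -
  have "\<Psi> p \<in> T" using assms(2,4) chart_basic(8) by (metis imageE subset_eq)
  then have "h differentiable (at (\<Psi> p))" using smooth_on_imp_differentiable[OF assms(3)] by blast
  from frechet_derivative_plane[OF this] show
    "Du (h \<circ> \<Psi>) p = Du \<Psi> p $ 1 *\<^sub>R Du h (\<Psi> p) + Du \<Psi> p $ 2 *\<^sub>R Dv h (\<Psi> p)"
    "Dv (h \<circ> \<Psi>) p = Dv \<Psi> p $ 1 *\<^sub>R Du h (\<Psi> p) + Dv \<Psi> p $ 2 *\<^sub>R Dv h (\<Psi> p)"
    unfolding Du_def[of "h \<circ> \<Psi>"] Dv_def[of "h \<circ> \<Psi>"] pushforward(2)[OF assms]
    by (simp_all add: Du_def[of \<Psi>] Dv_def[of \<Psi>])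
qed

context
  fixes s c n C e W
  assumes pc: "pure_frontal_chart s c n" and sub: "ball 0 s \<subseteq> V"
    and C: "C = c \<circ> \<Psi>" and e: "e = n \<circ> \<Psi>" and W: "W = \<Phi> ` ball 0 s"
begin

lemma pc_facts:
  "0 < s" "frontal_on (ball 0 s) c n"
  "q \<in> ball 0 s \<Longrightarrow> q $ 2 = 0 \<Longrightarrow> Dv c q = 0" "q \<in> ball 0 s \<Longrightarrow> q $ 2 = 0 \<Longrightarrow> Dv n q = 0"
  "q \<in> ball 0 s \<Longrightarrow> det3 (Du c q) (Dv_over_v c q) (n q) \<noteq> 0"
  using pc by (auto simp: pure_frontal_chart_def)

lemmas c_facts = frontal_onD[OF pc_facts(2)]
lemmas W_facts = ball_subset_image[OF sub pc_facts(1), folded W]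
lemmas C_facts = pushforward[OF open_ball sub c_facts(2), folded W C]
lemmas e_facts = pushforward[OF open_ball sub c_facts(3), folded W e]
lemmas C_partials = image_partials[OF open_ball sub c_facts(2), folded W C]
lemmas e_partials = image_partials[OF open_ball sub c_facts(3), folded W e]

lemma image_frontal: "frontal_on W C e"
proof -
  have "norm (e p) = 1 \<and> (\<forall>X. frechet_derivative C (at p) X \<bullet> e p = 0)" if p: "p \<in> W" for p
  proof -
    have q: "\<Psi> p \<in> ball 0 s" using p W_facts(4) by blast
    show ?thesis
      using pc_facts(2) q C_facts(2)[OF p] by (auto simp: frontal_on_def e)
  qed
  then show ?thesis
    using W_facts(1) C_facts(1) e_facts(1) by (auto simp: frontal_on_def)
qed

lemma image_sing_set: "sing_set W C = {p \<in> W. \<Psi> p $ 2 = 0}"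
proof -
  have "p \<in> sing_set W C \<longleftrightarrow> \<Psi> p $ 2 = 0" if p: "p \<in> W" for p
  proof -
    have q: "\<Psi> p \<in> ball 0 s" "p \<in> \<Phi> ` V" using p W_facts(4) by blast+
    have "p \<in> sing_set W C \<longleftrightarrow> (\<exists>X. X \<noteq> 0 \<and> frechet_derivative c (at (\<Psi> p)) (D\<Psi> p X) = 0)"
      using sing_set_iff_null_vector[OF p smooth_on_imp_differentiable[OF C_facts(1) p]] C_facts(2)[OF p] by simp
    also have "\<dots> \<longleftrightarrow> (\<exists>Y. Y \<noteq> 0 \<and> frechet_derivative c (at (\<Psi> p)) Y = 0)"
      using D_inverse[OF q(2)] D_nonzero(2)[OF q(2)] D_nonzero(1)[OF chart_basic(10)[OF q(2)]] by metis
    finally show ?thesis using pure_frontal_chart_null_vector[OF pc q(1)] by simp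
  qed
  then show ?thesis by (auto simp: sing_set_def)
qed

lemma image_curvatures:
  assumes "p \<in> W"
  shows "gauss_curvature C e p = gauss_curvature c n (\<Psi> p)" "mean_curvature C e p = mean_curvature c n (\<Psi> p)"
proof -
  have q: "\<Psi> p \<in> ball 0 s" "p \<in> \<Phi> ` V" using assms W_facts(4) by blast+
  show "gauss_curvature C e p = gauss_curvature c n (\<Psi> p)" "mean_curvature C e p = mean_curvature c n (\<Psi> p)"
    by (rule curvature_change_of_basis[OF C_partials[OF assms] e_partials[OF assms]
          frontal_second_form_symmetric[OF pc_facts(2) q(1)] chart_jacobian_nonzero[OF q(2)]])+
qed

text \<open>The function \<open>lam C e\<close> is the product of the coordinate \<open>v\<close> and a nonvanishing smooth function
\<open>\<Theta>\<close>, so at a zero of \<open>v\<close> its derivative is \<open>\<Theta>\<close> times that of \<open>v\<close>.\<close>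

lemma image_nondegenerate:
  assumes p: "p \<in> W" "\<Psi> p $ 2 = 0"
  shows "nondegenerate_point W C e p"
proof -
  have pV: "p \<in> \<Phi> ` V" and q: "\<Psi> p \<in> ball 0 s" using p W_facts(4) by blast+
  define J where "J x = Du \<Psi> x $ 1 * Dv \<Psi> x $ 2 - Du \<Psi> x $ 2 * Dv \<Psi> x $ 1" for x
  define \<Theta> where "\<Theta> x = J x * (\<lambda>q. det3 (Du c q) (Dv_over_v c q) (n q)) (\<Psi> x)" for x
  have lam: "lam C e x = \<Psi> x $ 2 * \<Theta> x" if x: "x \<in> W" for x
  proof -
    have "Dv c (\<Psi> x) = \<Psi> x $ 2 *\<^sub>R Dv_over_v c (\<Psi> x)"
      using x W_facts(4) pc_facts(3) by (intro Dv_eq_Dv_over_v) blast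
    then have "det3 (Du c (\<Psi> x)) (Dv c (\<Psi> x)) (n (\<Psi> x))
        = \<Psi> x $ 2 * det3 (Du c (\<Psi> x)) (Dv_over_v c (\<Psi> x)) (n (\<Psi> x))"
      by (simp add: det3_scaleR)
    then show ?thesis
      unfolding lam_def C_partials[OF x] det3_change_basis \<Theta>_def J_def by (simp add: e)
  qed
  have s\<Psi>: "smooth_on W \<Psi>" using smooth_on_subset[OF chart_basic(7) W_facts(3)] .
  have sJ: "smooth_on W J"
    unfolding J_def[abs_def]
    by (intro smooth_on_diff[OF W_facts(1)] smooth_on_mult[OF W_facts(1)]
        smooth_on_linear_comp[OF W_facts(1) bounded_linear_vec_nth] smooth_on_Du smooth_on_Dv s\<Psi>)
  have "smooth_on (ball 0 s) (\<lambda>q. det3 (Du c q) (Dv_over_v c q) (n q))"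
    by (intro smooth_on_det3 open_ball smooth_on_Du smooth_on_Dv_over_v c_facts pc_facts(3))
  then have "smooth_on W (\<lambda>x. (\<lambda>q. det3 (Du c q) (Dv_over_v c q) (n q)) (\<Psi> x))"
    using W_facts(4)
    by (intro smooth_on_compose[OF W_facts(1) open_ball _ _ s\<Psi>,
          where f = "\<lambda>q. det3 (Du c q) (Dv_over_v c q) (n q)"]) blast+
  then have "smooth_on W \<Theta>"
    unfolding \<Theta>_def[abs_def] by (intro smooth_on_mult[OF W_facts(1) sJ])
  from smooth_on_imp_has_derivative[OF this p(1)]
  have "(\<Theta> has_derivative frechet_derivative \<Theta> (at p)) (at p)" .
  from has_derivative_mult[OF bounded_linear.has_derivative[OF bounded_linear_vec_nth der_\<Psi>[OF pV], of 2] this]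
  have "((\<lambda>x. \<Psi> x $ 2 * \<Theta> x) has_derivative (\<lambda>X. D\<Psi> p X $ 2 * \<Theta> p)) (at p)"
    by (simp add: p(2))
  then have "(lam C e has_derivative (\<lambda>X. D\<Psi> p X $ 2 * \<Theta> p)) (at p)"
    by (rule has_derivative_transform_within_open[OF _ W_facts(1) p(1)]) (simp add: lam)
  then have "frechet_derivative (lam C e) (at p) = (\<lambda>X. D\<Psi> p X $ 2 * \<Theta> p)"
    using frechet_derivative_at by metis
  then have "frechet_derivative (lam C e) (at p) (D\<Phi> (\<Psi> p) (axis 2 1)) = \<Theta> p"
    using D_inverse(1)[OF pV] by simp
  moreover have "\<Theta> p \<noteq> 0"
    using chart_jacobian_nonzero[OF pV] pc_facts(5)[OF q] by (simp add: \<Theta>_def J_def)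
  ultimately show ?thesis
    using p by (auto simp: nondegenerate_point_def image_sing_set)
qed

text \<open>The witnesses are the image of the axis itself, centred at the given point, and the image of the
field \<open>(0, 1)\<close>. Along the curve the normal has derivative \<open>Dv n = 0\<close> in the direction of this null
field, which makes \<open>psi\<close> vanish.\<close>

lemma image_pure_frontal_point:
  assumes p: "p \<in> W" "\<Psi> p $ 2 = 0"
  shows "pure_frontal_point W C e p"
proof -
  define q0 where "q0 = \<Psi> p"
  have pV: "p \<in> \<Phi> ` V" and q0: "q0 \<in> ball 0 s" "q0 \<in> V" "\<Phi> q0 = p" "q0 $ 2 = 0"
    using p W_facts(4) chart_basic(9,10) by (auto simp: q0_def)
  define r where "r = s - norm q0"
  have r: "0 < r" using q0 by (simp add: r_def)
  have rs: "ball q0 r \<subseteq> ball 0 s"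
  proof
    fix x assume "x \<in> ball q0 r"
    then show "x \<in> ball 0 s"
      using norm_triangle_sub[of x q0] by (simp add: r_def dist_norm norm_minus_commute)
  qed
  define l where "l t = q0 + t *\<^sub>R axis 1 1" for t :: real
  define \<sigma> where "\<sigma> t = \<Phi> (l t)" for t
  define \<eta> where "\<eta> x = Dv \<Phi> (\<Psi> x)" for x
  have l_ball: "l t \<in> ball q0 r" if "t \<in> {-r<..<r}" for t
    using that by (auto simp: l_def dist_norm)
  have l_V: "l t \<in> V" if "t \<in> {-r<..<r}" for t using l_ball[OF that] rs sub by blast
  have l_axis: "l t $ 2 = 0" for t by (simp add: l_def q0)
  have dl: "(l has_vector_derivative axis 1 1) (at t)" for t
    unfolding l_def[abs_def] by (auto intro!: derivative_eq_intros)
  have d\<sigma>: "vector_derivative \<sigma> (at t) = D\<Phi> (l t) (axis 1 1)" if "t \<in> {-r<..<r}" for t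
    using curve_chain[OF dl der_\<Phi>[OF l_V[OF that]]] unfolding \<sigma>_def[abs_def] by (rule vector_derivative_at)
  have \<Psi>\<sigma>: "\<Psi> (\<sigma> t) = l t" "\<sigma> t \<in> W" "\<sigma> t \<in> \<Phi> ` V" if "t \<in> {-r<..<r}" for t
    using l_ball[OF that] rs l_V[OF that] by (auto simp: \<sigma>_def chart_basic W)
  have ax0: "axis i (1::real) \<noteq> (0 :: real^2)" for i by simp
  have img: "\<sigma> ` {-r<..<r} = sing_set W C \<inter> \<Phi> ` ball q0 r"
  proof
    show "\<sigma> ` {-r<..<r} \<subseteq> sing_set W C \<inter> \<Phi> ` ball q0 r"
      using \<Psi>\<sigma> l_axis l_ball by (auto simp: image_sing_set \<sigma>_def)
    show "sing_set W C \<inter> \<Phi> ` ball q0 r \<subseteq> \<sigma> ` {-r<..<r}"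
    proof
      fix x assume x: "x \<in> sing_set W C \<inter> \<Phi> ` ball q0 r"
      then obtain y where y: "y \<in> ball q0 r" "x = \<Phi> y" by blast
      have yV: "y \<in> V" using y(1) rs sub by blast
      have y2: "y $ 2 = 0" using x y(2) chart_basic(8)[OF yV] by (simp add: image_sing_set)
      have yl: "y = l (y $ 1 - q0 $ 1)" by (rule plane_eqI) (simp_all add: l_def y2 q0)
      have "dist q0 (l (y $ 1 - q0 $ 1)) < r" using y(1) yl by simp
      then have "\<bar>y $ 1 - q0 $ 1\<bar> < r" by (simp add: l_def dist_norm)
      then have "y $ 1 - q0 $ 1 \<in> {-r<..<r}" by auto
      then show "x \<in> \<sigma> ` {-r<..<r}" using yl y(2) by (metis \<sigma>_def imageI)
    qed
  qed
  have sc: "singular_curve W C p r \<sigma>"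
    unfolding singular_curve_def
  proof (intro conjI exI[of _ "\<Phi> ` ball q0 r"])
    show "0 < r" by (rule r)
    show "\<sigma> 0 = p" by (simp add: \<sigma>_def l_def q0)
    have "smooth_on {-r<..<r} l"
      unfolding l_def[abs_def]
      by (intro smooth_on_add smooth_on_const smooth_on_linear bounded_linear_scaleR_left) auto
    then show "smooth_on {-r<..<r} \<sigma>"
      unfolding \<sigma>_def[abs_def] using l_V
      by (intro smooth_on_compose[OF _ chart_basic(1) _ chart_basic(6)]) auto
    show "inj_on \<sigma> {-r<..<r}"
    proof (rule inj_onI)
      fix a b assume "a \<in> {-r<..<r}" "b \<in> {-r<..<r}" "\<sigma> a = \<sigma> b"
      then have "l a = l b" using \<Psi>\<sigma>(1) by metis
      then have "l a $ 1 = l b $ 1" by simp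
      then show "a = b" by (simp add: l_def)
    qed
    show "\<forall>t\<in>{-r<..<r}. vector_derivative \<sigma> (at t) \<noteq> 0"
      using d\<sigma> D_nonzero(1) l_V ax0 by metis
    show "open (\<Phi> ` ball q0 r)" using rs sub by (intro open_image) auto
    show "p \<in> \<Phi> ` ball q0 r" using q0(3) r by (metis centre_in_ball imageI)
    show "\<Phi> ` ball q0 r \<subseteq> W" using rs W by blast
  qed (rule img)
  have D\<eta>: "\<eta> x = D\<Phi> (\<Psi> x) (axis 2 1)" for x by (simp add: \<eta>_def Dv_def)
  have kill: "frechet_derivative h (at (\<Psi> x)) (D\<Psi> x (\<eta> x)) = Dv h (\<Psi> x)" if "x \<in> \<Phi> ` V"
    for x and h :: "real^2 \<Rightarrow> real^3"
    using D_inverse(1)[OF that] by (simp add: D\<eta> Dv_def)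
  have nf: "null_field C (\<sigma> ` {-r<..<r}) \<eta>"
    unfolding null_field_def
  proof (intro conjI exI[of _ "\<Phi> ` V"] ballI)
    show "smooth_on (\<Phi> ` V) \<eta>"
      using pushforward(1)[OF chart_basic(1) order_refl smooth_on_Dv[OF chart_basic(6)]]
      by (simp add: \<eta>_def[abs_def] o_def)
    show "\<eta> x \<noteq> 0" if "x \<in> \<Phi> ` V" for x
      unfolding D\<eta> using D_nonzero(1)[OF chart_basic(10)[OF that] ax0] .
    show "\<sigma> ` {-r<..<r} \<subseteq> \<Phi> ` V" using \<Psi>\<sigma> by blast
    show "frechet_derivative C (at x) (\<eta> x) = 0" if "x \<in> \<sigma> ` {-r<..<r}" for x
    proof -
      obtain t where t: "t \<in> {-r<..<r}" "x = \<sigma> t" using \<open>x \<in> \<sigma> ` {-r<..<r}\<close> by blast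
      show ?thesis
        using C_facts(2)[OF \<Psi>\<sigma>(2)[OF t(1)]] kill[OF \<Psi>\<sigma>(3)[OF t(1)]] \<Psi>\<sigma>(1)[OF t(1)]
          pc_facts(3) l_ball[OF t(1)] rs l_axis t(2) by auto
    qed
  qed (rule chart_basic(4))
  have indep: "a = 0 \<and> b = 0" if "a *\<^sub>R vector_derivative \<sigma> (at 0) + b *\<^sub>R \<eta> p = 0" for a b
  proof -
    have l0: "l 0 = q0" by (simp add: l_def)
    have "D\<Phi> q0 (a *\<^sub>R axis 1 1 + b *\<^sub>R axis 2 1) = 0"
      using that d\<sigma>[of 0] r l0 linear_D(1)[OF q0(2)]
      by (simp add: D\<eta> linear_add linear_scale flip: q0_def)
    then have "a *\<^sub>R axis 1 1 + b *\<^sub>R axis 2 1 = (0 :: real^2)"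
      using D_nonzero(1)[OF q0(2)] by blast
    then have "(a *\<^sub>R axis 1 1 + b *\<^sub>R axis 2 1 :: real^2) $ i = 0" for i by simp
    from this[of 1] this[of 2] show ?thesis by simp
  qed
  have "psi C e \<sigma> \<eta> t = 0" if "t \<in> {-r<..<r}" for t
    using e_facts(2)[OF \<Psi>\<sigma>(2)[OF that]] kill[OF \<Psi>\<sigma>(3)[OF that]] \<Psi>\<sigma>(1)[OF that]
      pc_facts(4) l_ball[OF that] rs l_axis by (auto simp: psi_def det3_zero)
  then show ?thesis
    unfolding pure_frontal_point_def first_kind_via_def
    using image_nondegenerate[OF p] sc nf indep by blast
qed

text \<open>A singular curve of \<open>f\<close> and one of \<open>C\<close> trace the same axis. Seen in the chart, the curve is a
continuous injection of an interval into that axis, so short arcs of it cover relatively open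
pieces of the axis, as the definition of a singular curve requires.\<close>

lemma image_singular_curve:
  assumes sm: "smooth_on U f" and ax: "sing_set V (f \<circ> \<Phi>) = {q \<in> V. q $ 2 = 0}"
    and \<gamma>: "singular_curve U f 0 \<epsilon> \<gamma>"
  shows "\<exists>\<delta>. 0 < \<delta> \<and> \<delta> \<le> \<epsilon> \<and> singular_curve W C 0 \<delta> \<gamma>"
proof -
  have \<epsilon>: "0 < \<epsilon>" "\<gamma> 0 = 0" and \<gamma>s: "smooth_on {-\<epsilon><..<\<epsilon>} \<gamma>" and inj: "inj_on \<gamma> {-\<epsilon><..<\<epsilon>}"
    and \<gamma>0: "\<And>t. t \<in> {-\<epsilon><..<\<epsilon>} \<Longrightarrow> vector_derivative \<gamma> (at t) \<noteq> 0"
    using \<gamma> unfolding singular_curve_def by blast+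
  have "open ({-\<epsilon><..<\<epsilon>} \<inter> \<gamma> -` W)"
    using continuous_on_open_vimage[OF open_greaterThanLessThan] W_facts(1)
      smooth_on_imp_continuous_on[OF \<gamma>s] by (metis Int_commute)
  moreover have "0 \<in> {-\<epsilon><..<\<epsilon>} \<inter> \<gamma> -` W" using \<epsilon> W_facts(2) by simp
  ultimately obtain \<delta> where \<delta>: "0 < \<delta>" "ball 0 \<delta> \<subseteq> {-\<epsilon><..<\<epsilon>} \<inter> \<gamma> -` W"
    using open_contains_ball by meson
  define I where "I = {-\<delta><..<\<delta>}"
  have I: "I \<subseteq> {-\<epsilon><..<\<epsilon>}" "\<gamma> ` I \<subseteq> W" and oI: "open I" and iI: "is_interval I"
    using \<delta>(2) by (auto simp: I_def dist_real_def subset_eq abs_less_iff is_interval_1)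
  have \<delta>\<epsilon>: "\<delta> \<le> \<epsilon>" using I(1) \<delta>(1) by (simp add: I_def greaterThanLessThan_subseteq_greaterThanLessThan)
  define \<alpha> where "\<alpha> t = \<Psi> (\<gamma> t) $ 1" for t
  have \<Psi>\<gamma>: "\<Psi> (\<gamma> t) $ 2 = 0" "\<gamma> t \<in> W" "\<gamma> t \<in> \<Phi> ` V" if "t \<in> I" for t
    using singular_curve_in_axis[OF sm ax \<gamma>, of t] I W_facts(3) that by blast+
  have cont: "continuous_on I \<alpha>"
    unfolding \<alpha>_def
    by (intro continuous_on_component continuous_on_compose2[OF smooth_on_imp_continuous_on[OF chart_basic(7)]]
        continuous_on_subset[OF smooth_on_imp_continuous_on[OF \<gamma>s] I(1)]) (use \<Psi>\<gamma> in blast)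
  have inj\<alpha>: "inj_on \<alpha> I"
  proof (rule inj_onI)
    fix a b assume ab: "a \<in> I" "b \<in> I" "\<alpha> a = \<alpha> b"
    then have "\<Psi> (\<gamma> a) = \<Psi> (\<gamma> b)" using \<Psi>\<gamma>(1) by (intro plane_eqI) (simp_all add: \<alpha>_def)
    then have "\<gamma> a = \<gamma> b" using \<Psi>\<gamma>(3) ab chart_basic(9) by metis
    then show "a = b" using inj ab I(1) by (meson inj_onD subsetD)
  qed
  have o\<alpha>: "open (\<alpha> ` I)"
    using injective_eq_1d_open_map_UNIV[OF cont iI] inj\<alpha> oI by blast
  \<comment> \<open>The image of this strip meets the singular set exactly in the short arc.\<close>
  define T where "T = ball 0 s \<inter> (\<lambda>q :: real^2. q $ 1) -` (\<alpha> ` I)"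
  have oT: "open T"
    unfolding T_def using open_vimage[OF o\<alpha>] by (intro open_Int open_ball open_vimage[OF o\<alpha>] continuous_intros)
  have TV: "T \<subseteq> V" using sub by (auto simp: T_def)
  have img: "\<gamma> ` I = sing_set W C \<inter> \<Phi> ` T"
  proof
    show "\<gamma> ` I \<subseteq> sing_set W C \<inter> \<Phi> ` T"
    proof
      fix x assume "x \<in> \<gamma> ` I"
      then obtain t where t: "t \<in> I" "x = \<gamma> t" by blast
      have "\<Psi> x \<in> T" using t W_facts(4)[of x] \<Psi>\<gamma>(2)[OF t(1)] by (auto simp: T_def \<alpha>_def)
      then have "x \<in> \<Phi> ` T" using chart_basic(9)[OF \<Psi>\<gamma>(3)[OF t(1)]] t(2) by (metis imageI)
      then show "x \<in> sing_set W C \<inter> \<Phi> ` T" using \<Psi>\<gamma>[OF t(1)] t(2) by (simp add: image_sing_set)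
    qed
    show "sing_set W C \<inter> \<Phi> ` T \<subseteq> \<gamma> ` I"
    proof
      fix x assume x: "x \<in> sing_set W C \<inter> \<Phi> ` T"
      then obtain y where y: "y \<in> T" "x = \<Phi> y" by blast
      have yV: "y \<in> V" using y(1) TV by blast
      obtain t where t: "t \<in> I" "y $ 1 = \<alpha> t" using y(1) by (auto simp: T_def)
      have "y $ 2 = 0" using x y(2) chart_basic(8)[OF yV] by (simp add: image_sing_set)
      then have "y = \<Psi> (\<gamma> t)" using t \<Psi>\<gamma>(1)[OF t(1)] by (intro plane_eqI) (simp_all add: \<alpha>_def)
      then show "x \<in> \<gamma> ` I" using y(2) chart_basic(9)[OF \<Psi>\<gamma>(3)[OF t(1)]] t(1) by simp
    qed
  qed
  have "singular_curve W C 0 \<delta> \<gamma>"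
    unfolding singular_curve_def I_def[symmetric]
  proof (intro conjI exI[of _ "\<Phi> ` T"])
    show "smooth_on I \<gamma>" "inj_on \<gamma> I"
      using \<gamma>s inj I(1) smooth_on_subset inj_on_subset by blast+
    show "\<forall>t\<in>I. vector_derivative \<gamma> (at t) \<noteq> 0" using \<gamma>0 I(1) by blast
    show "open (\<Phi> ` T)" by (rule open_image[OF oT TV])
    have "0 \<in> I" using \<delta> by (simp add: I_def)
    then have "\<gamma> 0 \<in> \<Phi> ` T" using img by blast
    then show "0 \<in> \<Phi> ` T" using \<epsilon> by simp
    show "\<Phi> ` T \<subseteq> W" by (auto simp: T_def W)
  qed (use \<delta> \<epsilon> img in auto)
  then show ?thesis using \<delta> \<delta>\<epsilon> by blast
qed

end

end

section \<open>The principal curvatures in adapted coordinates\<close>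

lemma isCont_pos_near:
  fixes f :: "real^2 \<Rightarrow> real"
  assumes "isCont f 0" "f 0 > 0"
  shows "\<exists>s>0. \<forall>q\<in>ball 0 s. f q > 0"
proof -
  obtain s where "s > 0" and s: "\<forall>q. dist q 0 < s \<longrightarrow> dist (f q) (f 0) < f 0"
    using assms unfolding continuous_at_eps_delta by blast
  moreover have "f q > 0" if "q \<in> ball 0 s" for q
    using s[rule_format, of q] that by (simp add: dist_real_def dist_commute abs_less_iff)
  ultimately show ?thesis by blast
qed

text \<open>The data of adapted coordinates on a disc on which \<open>v\<close> also divides \<open>Dv m\<close>.\<close>

locale adapted_ball =
  fixes r :: real and g m :: "real^2 \<Rightarrow> real^3"
  assumes r: "0 < r" and fr: "frontal_on (ball 0 r) g m"
    and ax: "q \<in> ball 0 r \<Longrightarrow> q $ 2 = 0 \<Longrightarrow>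
      Dv g q = 0 \<and> Dv m q = 0 \<and> norm (Du g q) = 1 \<and> norm (Dv (Dv g) q) = 1 \<and> Du g q \<bullet> Dv (Dv g) q = 0"
begin

abbreviation "h \<equiv> Dv_over_v g"
abbreviation "l \<equiv> Dv_over_v m"
abbreviation "E \<equiv> Et g"
abbreviation "F \<equiv> Ft g"
abbreviation "G \<equiv> Gt g"
abbreviation "L \<equiv> Lt g m"
abbreviation "M \<equiv> Mt g m"
abbreviation "N \<equiv> N1t g m"
abbreviation "\<Delta> q \<equiv> E q * G q - (F q)\<^sup>2"

lemma zero_in: "0 \<in> ball 0 r" using r by simp

lemmas g_facts = frontal_onD[OF fr]

lemma Dv_g: "q \<in> ball 0 r \<Longrightarrow> Dv g q = q $ 2 *\<^sub>R h q"
  and Dv_m: "q \<in> ball 0 r \<Longrightarrow> Dv m q = q $ 2 *\<^sub>R l q"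
  using ax by (auto intro!: Dv_eq_Dv_over_v)

lemma smooth_basic:
  "smooth_on (ball 0 r) (Du g)" "smooth_on (ball 0 r) h" "smooth_on (ball 0 r) (Du m)" "smooth_on (ball 0 r) l"
  using smooth_on_Du smooth_on_Dv_over_v g_facts ax by blast+

lemma smooth_forms:
  "smooth_on (ball 0 r) E" "smooth_on (ball 0 r) F" "smooth_on (ball 0 r) G"
  "smooth_on (ball 0 r) L" "smooth_on (ball 0 r) M" "smooth_on (ball 0 r) N"
  unfolding Et_def[abs_def] Ft_def[abs_def] Gt_def[abs_def] Lt_def[abs_def] Mt_def[abs_def] N1t_def[abs_def]
  by (intro smooth_on_uminus smooth_on_inner open_ball smooth_basic)+

text \<open>These are the orthogonality and symmetry relations of \<open>Dv g\<close> and \<open>Dv m\<close>, divided by \<open>v\<close>.\<close>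

lemma h_m: assumes "q \<in> ball 0 r" shows "h q \<bullet> m q = 0" "l q \<bullet> m q = 0" "Du g q \<bullet> l q = h q \<bullet> Du m q"
proof -
  have c: "continuous_on (ball 0 r) h" "continuous_on (ball 0 r) l" "continuous_on (ball 0 r) m"
    "continuous_on (ball 0 r) (Du g)" "continuous_on (ball 0 r) (Du m)"
    by (intro smooth_on_imp_continuous_on smooth_basic g_facts)+
  have off: "h q \<bullet> m q = 0" "l q \<bullet> m q = 0" "Du g q \<bullet> l q - h q \<bullet> Du m q = 0"
    if q: "q \<in> ball 0 r" "q $ 2 \<noteq> 0" for q
    using g_facts(6)[OF q(1)] frontal_normal_derivative_orthogonal(2)[OF fr q(1)]
      frontal_second_form_symmetric[OF fr q(1)] q(2) Dv_g[OF q(1)] Dv_m[OF q(1)]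
    by (auto simp: inner_commute)
  show "h q \<bullet> m q = 0"
    by (rule zero_off_axis_imp_zero[where f = "\<lambda>q. h q \<bullet> m q", OF open_ball _ _ assms])
      (intro continuous_on_inner c, rule off(1))
  show "l q \<bullet> m q = 0"
    by (rule zero_off_axis_imp_zero[where f = "\<lambda>q. l q \<bullet> m q", OF open_ball _ _ assms])
      (intro continuous_on_inner c, rule off(2))
  have "Du g q \<bullet> l q - h q \<bullet> Du m q = 0"
    by (rule zero_off_axis_imp_zero[where f = "\<lambda>q. Du g q \<bullet> l q - h q \<bullet> Du m q", OF open_ball _ _ assms])
      (intro continuous_on_diff continuous_on_inner c, rule off(3))
  then show "Du g q \<bullet> l q = h q \<bullet> Du m q" by simp
qed

lemma inner_products:
  assumes "q \<in> ball 0 r"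
  shows "Du g q \<bullet> Du g q = E q" "Du g q \<bullet> h q = F q" "h q \<bullet> Du g q = F q" "h q \<bullet> h q = G q"
    "Du m q \<bullet> Du g q = - L q" "Du m q \<bullet> h q = - M q" "l q \<bullet> Du g q = - M q" "l q \<bullet> h q = - N q"
    "Du g q \<bullet> m q = 0" "h q \<bullet> m q = 0" "m q \<bullet> Du g q = 0" "m q \<bullet> h q = 0"
    "Du m q \<bullet> m q = 0" "l q \<bullet> m q = 0" "m q \<bullet> m q = 1"
  using h_m[OF assms] frontal_normal_derivative_orthogonal(1)[OF fr assms] g_facts(4,5)[OF assms]
  by (simp_all add: Et_def Ft_def Gt_def Lt_def Mt_def N1t_def inner_commute)

lemma det_frame: "q \<in> ball 0 r \<Longrightarrow> (det3 (Du g q) (h q) (m q))\<^sup>2 = \<Delta> q"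
  using det3_square[of "Du g q" "m q" "h q"] inner_products[of q] by simp

lemma axis_values:
  assumes "q \<in> ball 0 r" "q $ 2 = 0"
  shows "E q = 1" "F q = 0" "G q = 1"
  using ax[OF assms] assms(2) by (auto simp: Et_def Ft_def Gt_def Dv_over_v_def norm_eq_1)

lemma isCont_0:
  fixes f :: "real^2 \<Rightarrow> 'b::real_normed_vector"
  shows "smooth_on (ball 0 r) f \<Longrightarrow> isCont f 0"
  using smooth_on_imp_continuous_on zero_in continuous_on_eq_continuous_at open_ball by blast

lemma isCont_forms: "isCont E 0" "isCont F 0" "isCont G 0" "isCont L 0" "isCont M 0" "isCont N 0"
  by (intro isCont_0 smooth_forms)+

lemma isCont_H: "isCont (Hext g m) 0" and isCont_K: "isCont (Kext g m) 0"
  unfolding Hext_def[abs_def] Kext_def[abs_def]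
  using axis_values[OF zero_in] by (intro continuous_intros isCont_forms; simp)+

text \<open>The cuspidal torsion \<open>M 0\<close> separates the two principal curvatures at the origin.\<close>

lemma H_K_at_0: "(Hext g m 0)\<^sup>2 - Kext g m 0 = ((L 0 - N 0) / 2)\<^sup>2 + (M 0)\<^sup>2"
  using axis_values[OF zero_in] by (simp add: Hext_def Kext_def power2_eq_square field_simps)

lemma Kext_Hext:
  assumes "\<Delta> q \<noteq> 0"
  shows "L q * N q - (M q)\<^sup>2 = \<Delta> q * Kext g m q"
    "E q * N q - 2 * F q * M q + G q * L q = 2 * (\<Delta> q * Hext g m q)"
proof -
  have "x = d * (x / d)" "x = 2 * (d * (x / (2 * d)))" if "d \<noteq> 0" for x d :: real
    using that by simp_all
  then show "L q * N q - (M q)\<^sup>2 = \<Delta> q * Kext g m q"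
    "E q * N q - 2 * F q * M q + G q * L q = 2 * (\<Delta> q * Hext g m q)"
    unfolding Kext_def Hext_def using assms by blast+
qed

text \<open>This polynomial form, in which all coefficients are smooth across the axis, is what is
differentiated later.\<close>

lemma principal_curvature_quadratic:
  assumes "\<Delta> q \<noteq> 0" "(Hext g m q)\<^sup>2 - Kext g m q \<ge> 0"
  shows "\<Delta> q * (principal_curvature j g m q)\<^sup>2
    - (E q * N q - 2 * F q * M q + G q * L q) * principal_curvature j g m q + (L q * N q - (M q)\<^sup>2) = 0"
proof -
  let ?H = "Hext g m q" and ?K = "Kext g m q" and ?k = "principal_curvature j g m q"
  have "(?k - ?H)\<^sup>2 = ?H\<^sup>2 - ?K"
    using assms(2) by (simp add: principal_curvature_def)
  then have "?k\<^sup>2 - 2 * ?H * ?k + ?K = 0" by (simp add: power2_eq_square algebra_simps)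
  then have "\<Delta> q * (?k\<^sup>2 - 2 * ?H * ?k + ?K) = 0" by simp
  then show ?thesis unfolding Kext_Hext[OF assms(1)] by (simp add: algebra_simps)
qed

end

section \<open>The focal surface in adapted coordinates\<close>

lemma D_inverse_function:
  fixes \<phi> :: "real^2 \<Rightarrow> real"
  assumes "\<phi> differentiable (at q)" "\<phi> q \<noteq> 0"
  shows "Du (\<lambda>x. 1 / \<phi> x) q = - Du \<phi> q / (\<phi> q)\<^sup>2" "Dv (\<lambda>x. 1 / \<phi> x) q = - Dv \<phi> q / (\<phi> q)\<^sup>2"
proof -
  have "((\<lambda>x. 1 / \<phi> x) has_derivative (\<lambda>X. - (X $ 1 * Du \<phi> q + X $ 2 * Dv \<phi> q) / (\<phi> q)\<^sup>2)) (at q)"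
    using has_derivative_plane[OF assms(1)] assms(2)
    by (auto intro!: derivative_eq_intros simp: power2_eq_square divide_simps)
  from Du_eqI[OF this] Dv_eqI[OF this]
  show "Du (\<lambda>x. 1 / \<phi> x) q = - Du \<phi> q / (\<phi> q)\<^sup>2" "Dv (\<lambda>x. 1 / \<phi> x) q = - Dv \<phi> q / (\<phi> q)\<^sup>2"
    by simp_all
qed

lemma Dv_slice:
  fixes f :: "real^2 \<Rightarrow> real"
  assumes "f differentiable (at q)"
  shows "((\<lambda>t. f (q + t *\<^sub>R axis 2 1)) has_real_derivative Dv f q) (at 0)"
proof -
  have "((\<lambda>t. q + t *\<^sub>R axis 2 1) has_vector_derivative axis 2 1) (at (0::real))"
    by (auto intro!: derivative_eq_intros)
  from curve_chain[OF this, of f] has_derivative_plane[OF assms]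
  have "((\<lambda>t. f (q + t *\<^sub>R axis 2 1)) has_vector_derivative Dv f q) (at 0)"
    by fastforce
  then show ?thesis by (simp add: has_real_derivative_iff_has_vector_derivative)
qed

text \<open>The disc is small enough for \<open>\<kappa>\<^sub>j\<close> and the unit normal of the focal surface to be smooth on it. The
hypothesis \<open>rc\<close> is the vanishing of the secondary cuspidal curvature.\<close>

locale focal_ball = adapted_ball +
  fixes j :: nat
  assumes discr: "q \<in> ball 0 r \<Longrightarrow> \<Delta> q > 0 \<and> (Hext g m q)\<^sup>2 - Kext g m q > 0"
    and kappa_nonzero: "q \<in> ball 0 r \<Longrightarrow> principal_curvature j g m q \<noteq> 0"
    and direction_nonzero: "q \<in> ball 0 r \<Longrightarrow> focal_direction j g m q \<noteq> 0"
    and torsion: "M 0 \<noteq> 0"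
    and rc: "q \<in> ball 0 r \<Longrightarrow> q $ 2 = 0 \<Longrightarrow> Dv N q - 2 * Dv F q * M q - Dv G q * N q = 0"
    and ridge: "first_order_ridge_point j g m 0"
begin

abbreviation "\<kappa> \<equiv> principal_curvature j g m"
abbreviation "x \<equiv> focal_direction j g m"
abbreviation "n \<equiv> focal_normal j g m"
abbreviation "c \<equiv> focal_surface j g m"
abbreviation "a q \<equiv> M q - \<kappa> q * F q"
abbreviation "b q \<equiv> L q - \<kappa> q * E q"
abbreviation "V\<kappa> \<equiv> along_field (principal_vector j g m) \<kappa>"

lemma smooth_kappa: "smooth_on (ball 0 r) \<kappa>"
proof -
  have H: "smooth_on (ball 0 r) (Hext g m)" and K: "smooth_on (ball 0 r) (Kext g m)"
    unfolding Hext_def[abs_def] Kext_def[abs_def] using discr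
    by (intro smooth_on_divide smooth_on_add smooth_on_diff smooth_on_mult smooth_on_power2 smooth_on_const
        open_ball smooth_forms; force)+
  show ?thesis
  proof (cases "j = 1")
    case True
    then show ?thesis
      unfolding principal_curvature_def[abs_def] using discr
      by simp (intro smooth_on_add smooth_on_sqrt smooth_on_diff smooth_on_power2 open_ball H K; simp)
  next
    case False
    then show ?thesis
      unfolding principal_curvature_def[abs_def] using discr
      by simp (intro smooth_on_sqrt smooth_on_diff smooth_on_power2 open_ball H K; simp)
  qed
qed

lemma quadratic: "q \<in> ball 0 r \<Longrightarrow>
   \<Delta> q * (\<kappa> q)\<^sup>2 - (E q * N q - 2 * F q * M q + G q * L q) * \<kappa> q + (L q * N q - (M q)\<^sup>2) = 0"
  by (rule principal_curvature_quadratic) (use discr[of q] in auto)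

lemma simple_root:
  assumes "q \<in> ball 0 r"
  shows "2 * \<Delta> q * \<kappa> q - (E q * N q - 2 * F q * M q + G q * L q) \<noteq> 0"
proof -
  have "E q * N q - 2 * F q * M q + G q * L q = 2 * (\<Delta> q * Hext g m q)"
    using Kext_Hext(2)[of q] discr[OF assms] by auto
  then have "2 * \<Delta> q * \<kappa> q - (E q * N q - 2 * F q * M q + G q * L q) = 2 * \<Delta> q * (\<kappa> q - Hext g m q)"
    by (simp add: algebra_simps)
  moreover have "\<kappa> q - Hext g m q \<noteq> 0"
    using discr[OF assms] by (auto simp: principal_curvature_def)
  ultimately show ?thesis using discr[OF assms] by (simp del: right_minus_eq)
qed

lemma differentiable:
  assumes "q \<in> ball 0 r"
  shows "\<kappa> differentiable (at q)" "E differentiable (at q)" "F differentiable (at q)" "G differentiable (at q)"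
    "L differentiable (at q)" "M differentiable (at q)" "N differentiable (at q)"
    "Du g differentiable (at q)" "Du m differentiable (at q)" "h differentiable (at q)" "l differentiable (at q)"
    "g differentiable (at q)" "m differentiable (at q)"
  using smooth_on_imp_differentiable[OF _ assms] smooth_kappa smooth_forms smooth_basic g_facts(2,3) by blast+

lemma smooth_ab: "smooth_on (ball 0 r) a" "smooth_on (ball 0 r) b"
  by (intro smooth_on_diff smooth_on_mult open_ball smooth_forms smooth_kappa)+

text \<open>
Rodrigues' formula \<open>dm(V) = - \<kappa> dg(V)\<close> for the principal vector \<open>V = - v a (1, 0) + b (0, 1)\<close>, divided
by \<open>v\<close>. It is checked against the frame \<open>Du g, h, m\<close>; the component along \<open>h\<close> is the quadratic
equation for \<open>\<kappa>\<close>.\<close>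

lemma rodrigues:
  assumes q: "q \<in> ball 0 r"
  shows "- a q *\<^sub>R Du m q + b q *\<^sub>R l q = - \<kappa> q *\<^sub>R x q"
proof -
  note P = inner_products[OF q]
  let ?w = "- a q *\<^sub>R Du m q + b q *\<^sub>R l q + \<kappa> q *\<^sub>R x q"
  have "det3 (Du g q) (h q) (m q) \<noteq> 0" using det_frame[OF q] discr[OF q] by auto
  moreover have "?w \<bullet> Du g q = 0" "?w \<bullet> m q = 0"
    unfolding focal_direction_def by (simp_all add: inner_simps P algebra_simps)
  moreover have "?w \<bullet> h q = 0"
    unfolding focal_direction_def using quadratic[OF q]
    by (simp add: inner_simps P power2_eq_square algebra_simps)
  ultimately have "?w = 0" using orthogonal_to_basis_imp_zero by blast
  then show ?thesis by (simp add: add_eq_0_iff2)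
qed

lemma focal_partials:
  assumes q: "q \<in> ball 0 r"
  shows "Du c q = Du g q + (1 / \<kappa> q) *\<^sub>R Du m q - (Du \<kappa> q / (\<kappa> q)\<^sup>2) *\<^sub>R m q"
    "Dv c q = q $ 2 *\<^sub>R h q + (q $ 2 / \<kappa> q) *\<^sub>R l q - (Dv \<kappa> q / (\<kappa> q)\<^sup>2) *\<^sub>R m q"
proof -
  note d = differentiable[OF q]
  have di: "(\<lambda>x. 1 / \<kappa> x) differentiable (at q)"
    using d(1) kappa_nonzero[OF q] by (intro differentiable_divide) auto
  have ds: "(\<lambda>x. (1 / \<kappa> x) *\<^sub>R m x) differentiable (at q)"
    using di d by (intro differentiable_scaleR)
  show "Du c q = Du g q + (1 / \<kappa> q) *\<^sub>R Du m q - (Du \<kappa> q / (\<kappa> q)\<^sup>2) *\<^sub>R m q"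
    "Dv c q = q $ 2 *\<^sub>R h q + (q $ 2 / \<kappa> q) *\<^sub>R l q - (Dv \<kappa> q / (\<kappa> q)\<^sup>2) *\<^sub>R m q"
    unfolding focal_surface_def[abs_def] D_add[OF d(12) ds] D_scaleR[OF di d(13)]
      D_inverse_function[OF d(1) kappa_nonzero[OF q]] Dv_g[OF q] Dv_m[OF q] by simp_all
qed

lemma along: "q \<in> ball 0 r \<Longrightarrow> V\<kappa> q = - (q $ 2 * a q) * Du \<kappa> q + b q * Dv \<kappa> q"
  using frechet_derivative_plane[OF differentiable(1)]
  by (simp add: along_field_def principal_vector_def)

text \<open>Rodrigues' formula cancels the tangential part of \<open>dc(V) = dg(V) + dm(V) / \<kappa> + V(1 / \<kappa>) m\<close>, so only the
last term survives. This identity ties the singularities of the focal surface to the ridges.\<close>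

lemma focal_image_of_principal_direction:
  assumes q: "q \<in> ball 0 r"
  shows "b q *\<^sub>R Dv c q - (q $ 2 * a q) *\<^sub>R Du c q = - (V\<kappa> q / (\<kappa> q)\<^sup>2) *\<^sub>R m q"
proof -
  have "b q *\<^sub>R Dv c q - (q $ 2 * a q) *\<^sub>R Du c q
    = q $ 2 *\<^sub>R x q + (q $ 2 / \<kappa> q) *\<^sub>R (- a q *\<^sub>R Du m q + b q *\<^sub>R l q) - (V\<kappa> q / (\<kappa> q)\<^sup>2) *\<^sub>R m q"
    unfolding focal_partials[OF q] along[OF q] focal_direction_def
    by (simp add: vec_eq_iff forall_3 field_simps)
  also have "\<dots> = - (V\<kappa> q / (\<kappa> q)\<^sup>2) *\<^sub>R m q"
    unfolding rodrigues[OF q] using kappa_nonzero[OF q] by simp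
  finally show ?thesis .
qed

lemma focal_direction_orthogonal:
  assumes q: "q \<in> ball 0 r"
  shows "Du c q \<bullet> x q = 0" "Dv c q \<bullet> x q = 0" "m q \<bullet> x q = 0"
proof -
  note P = inner_products[OF q]
  have mx: "m q \<bullet> x q = 0" by (simp add: focal_direction_def inner_simps P)
  have "x q \<bullet> (\<kappa> q *\<^sub>R Du g q + Du m q) = 0"
    unfolding focal_direction_def by (simp add: inner_simps P inner_commute[of _ "Du m q"] algebra_simps)
  then show "Du c q \<bullet> x q = 0"
    unfolding focal_partials[OF q] using kappa_nonzero[OF q] mx
    by (simp add: inner_simps inner_commute[of "x q"] field_simps)
  have "x q \<bullet> (\<kappa> q *\<^sub>R h q + l q) = 0"
    unfolding focal_direction_def using quadratic[OF q]
    by (simp add: inner_simps P inner_commute[of _ "l q"] power2_eq_square algebra_simps)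
  then have "q $ 2 * (x q \<bullet> (\<kappa> q *\<^sub>R h q + l q)) = 0" by simp
  then show "Dv c q \<bullet> x q = 0"
    unfolding focal_partials[OF q] using kappa_nonzero[OF q] mx
    by (simp add: inner_simps inner_commute[of "x q"] field_simps)
  show "m q \<bullet> x q = 0" by (rule mx)
qed

lemma focal_frontal: "frontal_on (ball 0 r) c n"
proof (rule frontal_onI[OF open_ball])
  have sx: "smooth_on (ball 0 r) x"
    unfolding focal_direction_def[abs_def]
    by (intro smooth_on_add smooth_on_scaleR smooth_on_uminus smooth_ab smooth_basic open_ball)
  show "smooth_on (ball 0 r) c"
    unfolding focal_surface_def[abs_def]
    by (intro smooth_on_add smooth_on_scaleR smooth_on_divide smooth_on_const open_ball smooth_kappa kappa_nonzero g_facts)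
  have "smooth_on (ball 0 r) (\<lambda>q. norm (x q))"
    unfolding norm_eq_sqrt_inner using direction_nonzero
    by (intro smooth_on_sqrt smooth_on_inner open_ball sx) auto
  then show "smooth_on (ball 0 r) n"
    unfolding focal_normal_def[abs_def] using direction_nonzero
    by (intro smooth_on_scaleR smooth_on_inverse open_ball sx) auto
  fix q :: "real^2" assume q: "q \<in> ball 0 r"
  show "norm (n q) = 1" using direction_nonzero[OF q] by (simp add: focal_normal_def)
  show "Du c q \<bullet> n q = 0" "Dv c q \<bullet> n q = 0"
    using focal_direction_orthogonal[OF q] by (simp_all add: focal_normal_def)
qed

text \<open>On the axis \<open>Dv g\<close> and \<open>Dv m\<close> vanish identically, hence so do their \<open>u\<close>-derivatives.\<close>

lemma mixed_axis:
  assumes q: "q \<in> ball 0 r" "q $ 2 = 0"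
  shows "Dv (Du g) q = 0" "Dv (Du m) q = 0"
proof -
  have coord: "(\<lambda>y::real^2. y $ 2) differentiable (at q)"
    using smooth_on_imp_differentiable[OF smooth_on_coord[OF open_ball] q(1)] .
  have "Du (Dv g) q = Du (\<lambda>y. y $ 2 *\<^sub>R h y) q"
    using smooth_on_imp_differentiable[OF smooth_on_Dv[OF g_facts(2)] q(1)] Dv_g
    by (intro Du_cong[OF open_ball q(1)])
  also have "\<dots> = 0"
    unfolding D_scaleR[OF coord differentiable(10)[OF q(1)]] by (simp add: D_coord2 q)
  finally show "Dv (Du g) q = 0" using Du_Dv_commute[OF open_ball q(1) g_facts(2)] by simp
  have "Du (Dv m) q = Du (\<lambda>y. y $ 2 *\<^sub>R l y) q"
    using smooth_on_imp_differentiable[OF smooth_on_Dv[OF g_facts(3)] q(1)] Dv_m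
    by (intro Du_cong[OF open_ball q(1)])
  also have "\<dots> = 0"
    unfolding D_scaleR[OF coord differentiable(11)[OF q(1)]] by (simp add: D_coord2 q)
  finally show "Dv (Du m) q = 0" using Du_Dv_commute[OF open_ball q(1) g_facts(3)] by simp
qed

lemma Du_m_axis:
  assumes q: "q \<in> ball 0 r" "q $ 2 = 0"
  shows "Du m q = - L q *\<^sub>R Du g q - M q *\<^sub>R h q"
proof -
  note P = inner_products[OF q(1)] axis_values[OF q]
  have "det3 (Du g q) (h q) (m q) \<noteq> 0" using det_frame[OF q(1)] discr[OF q(1)] by auto
  then have "Du m q - (- L q *\<^sub>R Du g q - M q *\<^sub>R h q) = 0"
    by (rule orthogonal_to_basis_imp_zero) (simp_all add: inner_simps P)
  then show ?thesis by simp
qed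

text \<open>Differentiate the quadratic equation of \<open>\<kappa>\<close> in the \<open>v\<close>-direction at a point of the axis. There \<open>E\<close> and
\<open>L\<close> have zero derivative and \<open>Dv M = L Dv F + M Dv G / 2\<close>. Substituting
\<open>Dv N = 2 M Dv F + N Dv G\<close>, which is the vanishing of the secondary cuspidal curvature, turns the
derivative of the coefficients into \<open>Dv G\<close> times the quadratic itself, that is, zero. As \<open>\<kappa>\<close> is a
simple root, \<open>Dv \<kappa> = 0\<close>.\<close>

lemma Dv_kappa_axis:
  assumes q: "q \<in> ball 0 r" "q $ 2 = 0"
  shows "Dv \<kappa> q = 0"
proof -
  note d = differentiable[OF q(1)] and P = inner_products[OF q(1)] and A = axis_values[OF q] and mx = mixed_axis[OF q]
  have E': "Dv E q = 0" and L': "Dv L q = 0" and F': "Dv F q = Du g q \<bullet> Dv h q" and G': "Dv G q = 2 * (h q \<bullet> Dv h q)"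
    and M': "Dv M q = - (Dv h q \<bullet> Du m q)"
    unfolding Et_def[abs_def] Ft_def[abs_def] Gt_def[abs_def] Lt_def[abs_def] Mt_def[abs_def]
    using d mx by (simp_all add: D_minus D_inner inner_commute)
  have M'': "Dv M q = L q * Dv F q + M q * Dv G q / 2"
    unfolding M' F' G' Du_m_axis[OF q] by (simp add: inner_simps inner_commute)
  have N': "Dv N q = 2 * Dv F q * M q + Dv G q * N q" using rc[OF q] by simp
  let ?p = "\<lambda>t. q + t *\<^sub>R axis 2 1 :: real^2"
  let ?Q = "\<lambda>q. \<Delta> q * (\<kappa> q)\<^sup>2 - (E q * N q - 2 * F q * M q + G q * L q) * \<kappa> q + (L q * N q - (M q)\<^sup>2)"
  note s = Dv_slice[OF d(1)] Dv_slice[OF d(2)] Dv_slice[OF d(3)] Dv_slice[OF d(4)] Dv_slice[OF d(5)]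
    Dv_slice[OF d(6)] Dv_slice[OF d(7)]
  have 1: "((\<lambda>t. ?Q (?p t)) has_real_derivative
     (Dv G q * (\<kappa> q)\<^sup>2 + 2 * \<kappa> q * Dv \<kappa> q) - ((Dv N q - 2 * Dv F q * M q + Dv G q * L q) * \<kappa> q + (N q + L q) * Dv \<kappa> q)
     + (L q * Dv N q - 2 * M q * Dv M q)) (at 0)"
    by (rule derivative_eq_intros s refl | simp add: A E' L' algebra_simps power2_eq_square)+
  have "((\<lambda>t. ?Q (?p t)) has_real_derivative 0) (at 0)"
  proof (rule has_field_derivative_transform_within_open[where f = "\<lambda>t. 0"])
    show "open (?p -` ball 0 r)" by (intro open_vimage open_ball continuous_intros)
    show "0 = ?Q (?p t)" if "t \<in> ?p -` ball 0 r" for t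
      using quadratic[of "?p t"] that by simp
  qed (use q in auto)
  from DERIV_unique[OF 1 this]
  have "(2 * \<kappa> q - (N q + L q)) * Dv \<kappa> q =
     - Dv G q * ((\<kappa> q)\<^sup>2 - (N q + L q) * \<kappa> q + (L q * N q - (M q)\<^sup>2))"
    unfolding M'' N' by (simp add: algebra_simps power2_eq_square)
  also have "\<dots> = 0" using quadratic[OF q(1)] by (simp add: A)
  finally show ?thesis using simple_root[OF q(1)] by (simp add: A)
qed

text \<open>The tangential part of \<open>Du c\<close> and the vector \<open>x\<close>, expressed in the orthonormal frame at the origin,
have determinant \<open>((\<kappa> - L)\<^sup>2 + M\<^sup>2) / \<kappa>\<close> up to sign; nonzero torsion keeps it away from zero.\<close>

lemma det_at_0: "det3 (Du c 0) (m 0) (n 0) \<noteq> 0"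
proof -
  note A = axis_values[OF zero_in] and k = kappa_nonzero[OF zero_in]
  let ?d = "det3 (Du g 0) (h 0) (m 0)"
  have d: "?d \<noteq> 0" using det_frame[OF zero_in] A by auto
  have "det3 (Du c 0) (m 0) (x 0) = ((\<kappa> 0 - L 0)\<^sup>2 + (M 0)\<^sup>2) / \<kappa> 0 * ?d"
    unfolding focal_partials[OF zero_in] focal_direction_def Du_m_axis[OF zero_in zero_index] det3_expand
    using k by (simp add: A field_simps power2_eq_square)
  moreover have "(\<kappa> 0 - L 0)\<^sup>2 + (M 0)\<^sup>2 \<noteq> 0" using torsion by (simp add: sum_power2_eq_zero_iff)
  ultimately show ?thesis
    using k d direction_nonzero[OF zero_in] by (simp add: focal_normal_def det3_scaleR)
qed

lemma focal_Dv_axis: "q \<in> ball 0 r \<Longrightarrow> q $ 2 = 0 \<Longrightarrow> Dv c q = 0"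
  by (simp add: focal_partials Dv_kappa_axis)

text \<open>Differentiating \<open>b Dv c - v a Du c = \<phi> m\<close>, where \<open>\<phi> = - V\<kappa> / \<kappa>\<^sup>2\<close>, in the \<open>v\<close>-direction at the origin gives
\<open>b Dv (Dv c) = a Du c + (Dv \<phi>) m\<close>. As the principal vector at the origin is \<open>(0, b)\<close>,
the first order ridge condition yields \<open>\<phi> = 0\<close> and \<open>Dv \<phi> \<noteq> 0\<close> there.\<close>

lemma focal_det_at_0: "det3 (Du c 0) (Dv (Dv c) 0) (n 0) \<noteq> 0"
proof -
  note Z = zero_in and fc = frontal_onD[OF focal_frontal]
  have sV: "smooth_on (ball 0 r) V\<kappa>"
  proof (rule smooth_on_cong[OF open_ball])
    show "smooth_on (ball 0 r) (\<lambda>q. - (q $ 2 * a q) * Du \<kappa> q + b q * Dv \<kappa> q)"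
      by (intro smooth_on_add smooth_on_mult smooth_on_uminus smooth_on_coord smooth_ab smooth_on_Du smooth_on_Dv
          smooth_kappa open_ball)
  qed (simp add: along)
  have dV: "V\<kappa> differentiable (at 0)" using smooth_on_imp_differentiable[OF sV Z] .
  have V0: "V\<kappa> 0 = 0" and "along_field (principal_vector j g m) V\<kappa> 0 \<noteq> 0"
    using ridge by (simp_all add: first_order_ridge_point_def Let_def)
  then have DV: "Dv V\<kappa> 0 \<noteq> 0"
    using frechet_derivative_plane[OF dV] by (auto simp: along_field_def principal_vector_def)
  have dk2: "(\<lambda>q. (\<kappa> q)\<^sup>2) differentiable (at 0)" and dab: "a differentiable (at 0)" "b differentiable (at 0)"
    and dcoord: "(\<lambda>q::real^2. q $ 2) differentiable (at 0)"
    and dc: "Dv c differentiable (at 0)" "Du c differentiable (at 0)"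
    by (rule smooth_on_imp_differentiable[OF _ Z]; intro smooth_on_power2 smooth_kappa smooth_ab
        smooth_on_coord open_ball smooth_on_Du smooth_on_Dv fc)+
  define \<phi> where "\<phi> q = - (V\<kappa> q / (\<kappa> q)\<^sup>2)" for q
  have s\<phi>: "smooth_on (ball 0 r) \<phi>"
    unfolding \<phi>_def[abs_def] using kappa_nonzero
    by (intro smooth_on_uminus smooth_on_divide smooth_on_power2 smooth_kappa sV open_ball) auto
  have d\<phi>: "\<phi> differentiable (at 0)" using smooth_on_imp_differentiable[OF s\<phi> Z] .
  have "Dv V\<kappa> 0 = Dv (\<lambda>q. \<phi> q * - (\<kappa> q)\<^sup>2) 0"
    by (rule Dv_cong[OF open_ball Z dV]) (use kappa_nonzero in \<open>simp add: \<phi>_def\<close>)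
  also have "\<dots> = - (Dv \<phi> 0 * (\<kappa> 0)\<^sup>2)"
    using D_mult(2)[OF d\<phi> differentiable_minus[OF dk2]] V0 by (simp add: \<phi>_def)
  finally have D\<phi>: "Dv \<phi> 0 \<noteq> 0" using DV by auto
  have "Dv (\<lambda>q. b q *\<^sub>R Dv c q) 0 = Dv (\<lambda>q. q $ 2 *\<^sub>R (a q *\<^sub>R Du c q) + \<phi> q *\<^sub>R m q) 0"
  proof (rule Dv_cong[OF open_ball Z])
    show "(\<lambda>q. b q *\<^sub>R Dv c q) differentiable (at 0)" using dab dc by (intro differentiable_scaleR)
    show "b q *\<^sub>R Dv c q = q $ 2 *\<^sub>R (a q *\<^sub>R Du c q) + \<phi> q *\<^sub>R m q" if "q \<in> ball 0 r" for q
      using focal_image_of_principal_direction[OF that] by (simp add: \<phi>_def algebra_simps)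
  qed
  moreover have "Dv (\<lambda>q. b q *\<^sub>R Dv c q) 0 = b 0 *\<^sub>R Dv (Dv c) 0"
    using D_scaleR(2)[OF dab(2) dc(1)] focal_Dv_axis[OF Z] by simp
  moreover have "Dv (\<lambda>q. q $ 2 *\<^sub>R (a q *\<^sub>R Du c q) + \<phi> q *\<^sub>R m q) 0 = a 0 *\<^sub>R Du c 0 + Dv \<phi> 0 *\<^sub>R m 0"
    using D_add(2)[OF differentiable_scaleR[OF dcoord differentiable_scaleR[OF dab(1) dc(2)]]
        differentiable_scaleR[OF d\<phi> differentiable(13)[OF Z]]]
      D_scaleR(2)[OF dcoord differentiable_scaleR[OF dab(1) dc(2)]]
      D_scaleR(2)[OF d\<phi> differentiable(13)[OF Z]] V0
    by (simp add: D_coord2 \<phi>_def)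
  ultimately have "b 0 *\<^sub>R Dv (Dv c) 0 = a 0 *\<^sub>R Du c 0 + Dv \<phi> 0 *\<^sub>R m 0" by simp
  then have "b 0 * det3 (Du c 0) (Dv (Dv c) 0) (n 0) =
      det3 (1 *\<^sub>R Du c 0 + 0 *\<^sub>R m 0) (a 0 *\<^sub>R Du c 0 + Dv \<phi> 0 *\<^sub>R m 0) (n 0)"
    by (simp flip: det3_scaleR(2))
  also have "\<dots> = Dv \<phi> 0 * det3 (Du c 0) (m 0) (n 0)"
    unfolding det3_change_basis by simp
  finally show ?thesis using D\<phi> det_at_0 by auto
qed

text \<open>It remains to see that the focal normal \<open>n\<close> is stationary in the \<open>v\<close>-direction along the axis. By
\<open>det_at_0\<close> it suffices that \<open>Dv n\<close> is orthogonal to \<open>Du c\<close>, by symmetry of the second fundamental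
form and \<open>Dv c = 0\<close>; to \<open>m\<close>, because \<open>n\<close> is orthogonal to \<open>m\<close> and \<open>Dv m = 0\<close>; and to \<open>n\<close> itself.\<close>

theorem focal_pure_frontal_chart: "\<exists>s\<le>r. pure_frontal_chart s c n"
proof -
  note fc = frontal_onD[OF focal_frontal]
  have k: "smooth_on (ball 0 r) (Dv_over_v c)"
    using smooth_on_Dv_over_v fc(2) focal_Dv_axis by blast
  have "isCont (\<lambda>q. (det3 (Du c q) (m q) (n q))\<^sup>2) 0" "isCont (\<lambda>q. (det3 (Du c q) (Dv_over_v c q) (n q))\<^sup>2) 0"
    by (intro isCont_0 smooth_on_power2 smooth_on_det3 open_ball smooth_on_Du fc g_facts k)+
  then obtain s1 s2 where s1: "s1 > 0" "\<forall>q\<in>ball 0 s1. (det3 (Du c q) (m q) (n q))\<^sup>2 > 0"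
    and s2: "s2 > 0" "\<forall>q\<in>ball 0 s2. (det3 (Du c q) (Dv_over_v c q) (n q))\<^sup>2 > 0"
    using isCont_pos_near det_at_0 focal_det_at_0 zero_less_power2
    by (metis (no_types, lifting) Dv_over_v_def zero_index)
  define s where "s = min r (min s1 s2)"
  have s: "0 < s" "s \<le> r" "ball 0 s \<subseteq> ball 0 r" "ball 0 s \<subseteq> ball 0 s1" "ball 0 s \<subseteq> ball 0 s2"
    using r s1 s2 by (auto simp: s_def)
  have "pure_frontal_chart s c n"
    unfolding pure_frontal_chart_def
  proof (intro conjI ballI impI)
    show "frontal_on (ball 0 s) c n" using frontal_on_subset[OF focal_frontal open_ball s(3)] .
    fix q :: "real^2" assume q: "q \<in> ball 0 s"
    then have qr: "q \<in> ball 0 r" using s(3) by blast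
    show "det3 (Du c q) (Dv_over_v c q) (n q) \<noteq> 0" using s2(2) q s(5) by fastforce
    assume q2: "q $ 2 = 0"
    show cv: "Dv c q = 0" by (rule focal_Dv_axis[OF qr q2])
    show "Dv n q = 0"
    proof (rule orthogonal_to_basis_imp_zero)
      show "det3 (Du c q) (m q) (n q) \<noteq> 0" using s1(2) q s(4) by fastforce
      show "Dv n q \<bullet> Du c q = 0"
        using frontal_second_form_symmetric[OF focal_frontal qr] cv by (simp add: inner_commute)
      show "Dv n q \<bullet> n q = 0"
        using frontal_normal_derivative_orthogonal[OF focal_frontal qr] by (simp add: inner_commute)
      have "n y \<bullet> m y = 0" if "y \<in> ball 0 r" for y
        using focal_direction_orthogonal(3)[OF that] by (simp add: focal_normal_def inner_commute)
      from D_inner_const(2)[OF open_ball fc(3) g_facts(3) this qr]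
      show "Dv n q \<bullet> m q = 0" using Dv_m[OF qr] q2 by simp
    qed
  qed (rule s)
  then show ?thesis using s(2) by blast
qed

end

lemma (in adapted_ball) smaller_ball:
  assumes "0 < s" "s \<le> r"
  shows "adapted_ball s g m"
proof
  have sub: "ball 0 s \<subseteq> ball (0::real^2) r" using assms(2) by (rule subset_ball)
  show "frontal_on (ball 0 s) g m" using frontal_on_subset[OF fr open_ball sub] .
  show "Dv g q = 0 \<and> Dv m q = 0 \<and> norm (Du g q) = 1 \<and> norm (Dv (Dv g) q) = 1 \<and> Du g q \<bullet> Dv (Dv g) q = 0"
    if "q \<in> ball 0 s" "q $ 2 = 0" for q
    using ax that sub by blast
qed (rule assms)

text \<open>At the origin the frame is orthonormal, the torsion separates the principal curvatures, and the
focal direction has the nonzero component \<open>- M 0\<close> along \<open>Du g\<close>; by continuity all three persist, in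
the form of the inequalities of \<open>focal_ball\<close>, on a smaller disc.\<close>

lemma (in adapted_ball) exists_focal_ball:
  assumes nz: "\<And>q. q \<in> ball 0 r \<Longrightarrow> principal_curvature j g m q \<noteq> 0"
    and tors: "M 0 \<noteq> 0"
    and rc: "\<And>q. q \<in> ball 0 r \<Longrightarrow> q $ 2 = 0 \<Longrightarrow> Dv N q - 2 * Dv F q * M q - Dv G q * N q = 0"
    and ridge: "first_order_ridge_point j g m 0"
  shows "\<exists>s\<le>r. focal_ball s g m j"
proof -
  let ?d = "\<lambda>q. (Hext g m q)\<^sup>2 - Kext g m q" and ?x = "focal_direction j g m"
  note A = axis_values[OF zero_in] and C = isCont_forms
  have d0: "?d 0 > 0" unfolding H_K_at_0 using tors by (simp add: add_nonneg_pos)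
  have cd: "isCont ?d 0" "isCont \<Delta> 0" by (intro continuous_intros isCont_H isCont_K C)+
  have ck: "isCont (principal_curvature j g m) 0"
    unfolding principal_curvature_def[abs_def]
    by (cases "j = 1") (auto intro!: continuous_intros isCont_H isCont_K)
  have cx: "isCont (\<lambda>q. ?x q \<bullet> ?x q) 0"
    unfolding focal_direction_def by (intro continuous_intros C ck isCont_0 smooth_basic)
  have "?x 0 \<bullet> Du g 0 = - M 0"
    by (simp add: focal_direction_def inner_simps inner_products[OF zero_in] A)
  then have "?x 0 \<noteq> 0" using tors by auto
  then have x0: "?x 0 \<bullet> ?x 0 > 0" by simp
  have D0: "\<Delta> 0 > 0" using A by simp
  obtain s1 s2 s3 where s: "s1 > 0" "s2 > 0" "s3 > 0"
    and p: "\<forall>q\<in>ball 0 s1. ?d q > 0" "\<forall>q\<in>ball 0 s2. \<Delta> q > 0" "\<forall>q\<in>ball 0 s3. ?x q \<bullet> ?x q > 0"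
    using isCont_pos_near[OF cd(1) d0] isCont_pos_near[OF cd(2) D0] isCont_pos_near[OF cx x0] by blast
  define s where "s = min (min r s1) (min s2 s3)"
  have s': "0 < s" "s \<le> r" using s r by (auto simp: s_def)
  have sub: "q \<in> ball 0 r" "q \<in> ball 0 s1" "q \<in> ball 0 s2" "q \<in> ball 0 s3" if "q \<in> ball 0 s" for q :: "real^2"
    using that by (auto simp: s_def)
  interpret S: adapted_ball s g m by (rule smaller_ball[OF s'])
  have "focal_ball s g m j"
  proof
    fix q :: "real^2" assume q: "q \<in> ball 0 s"
    show "\<Delta> q > 0 \<and> (Hext g m q)\<^sup>2 - Kext g m q > 0" using p sub[OF q] by blast
    show "principal_curvature j g m q \<noteq> 0" using nz sub[OF q] by blast
    show "?x q \<noteq> 0" using p(3) sub(4)[OF q] by force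
    show "Dv N q - 2 * Dv F q * M q - Dv G q * N q = 0" if "q $ 2 = 0" using rc sub[OF q] that by blast
  qed (rule tors ridge)+
  then show ?thesis using s' by blast
qed

lemma pure_frontal_chart_smaller:
  assumes "pure_frontal_chart s c n" "0 < t" "t \<le> s"
  shows "pure_frontal_chart t c n"
proof -
  have "ball 0 t \<subseteq> ball (0::real^2) s" using assms(3) by (rule subset_ball)
  then show ?thesis
    using assms frontal_on_subset[OF _ open_ball, of "ball 0 s" c n 0 t] unfolding pure_frontal_chart_def by blast
qed

lemma (in chart) pullback_frontal:
  assumes "frontal_on U f \<nu>" shows "frontal_on V (f \<circ> \<Phi>) (\<nu> \<circ> \<Phi>)"
  using assms chart_basic(1,5) pullback[of f] pullback[of \<nu>]
  by (auto simp: frontal_on_def)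

section \<open>Pure-frontal singular points of the focal surface\<close>

theorem theorem4p12:
  fixes f \<nu> g m C e :: "real^2 \<Rightarrow> real^3"
    and \<Phi> \<Psi> :: "real^2 \<Rightarrow> real^2"
    and U V :: "(real^2) set"
    and \<gamma> :: "real \<Rightarrow> real^2" and \<epsilon> :: real
    and j :: nat
  assumes "frontal_on U f \<nu>" and "0 \<in> U" and "f 0 = 0"
    and "pure_frontal_point U f \<nu> 0"
    and "singular_curve U f 0 \<epsilon> \<gamma>"
    and "coordinate_change U V \<Phi> \<Psi>"
    and "g = f \<circ> \<Phi>" and "m = \<nu> \<circ> \<Phi>"
    and "adapted V g m"
    and "cuspidal_torsion g m 0 \<noteq> 0"
    and "\<forall>q\<in>V. principal_curvature 1 g m q \<noteq> 0 \<and> principal_curvature 2 g m q \<noteq> 0"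
    and "j \<in> {1, 2}"
    and "\<forall>u. vector [u, 0] \<in> V \<longrightarrow> secondary_cuspidal_curvature g m u = 0"
    and "first_order_ridge_point j g m 0"
    and "C = focal_surface j g m \<circ> \<Psi>" and "e = focal_normal j g m \<circ> \<Psi>"
  shows "\<exists>W. open W \<and> 0 \<in> W \<and> W \<subseteq> \<Phi> ` V \<and> frontal_on W C e \<and>
           (\<exists>\<delta>. 0 < \<delta> \<and> \<delta> \<le> \<epsilon> \<and> singular_curve W C 0 \<delta> \<gamma> \<and>
              (\<forall>t\<in>{-\<delta><..<\<delta>}. pure_frontal_point W C e (\<gamma> t))) \<and>
           (\<exists>B. \<forall>q \<in> W - sing_set W C.
              \<bar>gauss_curvature C e q\<bar> \<le> B \<and> \<bar>mean_curvature C e q\<bar> \<le> B)"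
proof -
  interpret chart U V \<Phi> \<Psi> by unfold_locales (rule assms(6))
  have fr: "frontal_on V g m" unfolding assms(7,8) by (rule pullback_frontal[OF assms(1)])
  obtain r where rV: "0 < r" "ball 0 r \<subseteq> V" and Dvm: "\<And>q. q \<in> ball 0 r \<Longrightarrow> q $ 2 = 0 \<Longrightarrow> Dv m q = 0"
    using pure_frontal_imp_normal_derivative_zero[OF assms(1,4)] assms(7-9) by metis
  have ad: "sing_set V g = {q \<in> V. q $ 2 = 0}"
    "\<And>q. q \<in> V \<Longrightarrow> q $ 2 = 0 \<Longrightarrow> Dv g q = 0 \<and> norm (Du g q) = 1 \<and> norm (Dv (Dv g) q) = 1 \<and>
       Du g q \<bullet> Dv (Dv g) q = 0"
    using assms(9) unfolding adapted_def by blast+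
  interpret adapted_ball r g m
    using rV frontal_on_subset[OF fr open_ball rV(2)] ad(2) Dvm by unfold_locales blast+
  have axis_point: "vector [q $ 1, 0] = q" if "q $ 2 = 0" for q :: "real^2"
    using that by (intro plane_eqI) simp_all
  have "\<exists>s\<le>r. focal_ball s g m j"
  proof (rule exists_focal_ball)
    show "principal_curvature j g m q \<noteq> 0" if "q \<in> ball 0 r" for q
      using assms(11,12) that rV(2) by blast
    show "Mt g m 0 \<noteq> 0"
      using assms(10) axis_point[of 0] by (simp add: cuspidal_torsion_def)
    show "Dv (N1t g m) q - 2 * Dv (Ft g) q * Mt g m q - Dv (Gt g) q * N1t g m q = 0"
      if q: "q \<in> ball 0 r" "q $ 2 = 0" for q
    proof -
      have "secondary_cuspidal_curvature g m (q $ 1) = 0"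
        using assms(13) axis_point[OF q(2)] q(1) rV(2) by auto
      then show ?thesis
        unfolding secondary_cuspidal_curvature_def axis_point[OF q(2)] by (simp add: Let_def)
    qed
  qed (rule assms(14))
  then obtain s0 where s0: "s0 \<le> r" "focal_ball s0 g m j" by blast
  let ?c = "focal_surface j g m" and ?n = "focal_normal j g m"
  obtain s1 where s1: "s1 \<le> s0" "pure_frontal_chart s1 ?c ?n"
    using focal_ball.focal_pure_frontal_chart[OF s0(2)] by blast
  obtain s B where s: "0 < s" "s \<le> s1" and B: "\<forall>q\<in>ball 0 s. q $ 2 \<noteq> 0 \<longrightarrow>
    \<bar>gauss_curvature ?c ?n q\<bar> \<le> B \<and> \<bar>mean_curvature ?c ?n q\<bar> \<le> B"
    using pure_frontal_chart_curvatures_bounded[OF s1(2)] by blast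
  have pc: "pure_frontal_chart s ?c ?n" using pure_frontal_chart_smaller[OF s1(2) s] .
  have "ball 0 s \<subseteq> ball (0::real^2) r" using s0(1) s1(1) s(2) by (intro subset_ball) simp
  then have sub: "ball 0 s \<subseteq> V" using rV(2) by blast
  define W where "W = \<Phi> ` ball 0 s"
  note image = pc sub assms(15,16) W_def
  note W = ball_subset_image[OF sub s(1), folded W_def]
  have sing: "sing_set W C = {p \<in> W. \<Psi> p $ 2 = 0}" by (rule image_sing_set[OF image])
  obtain \<delta> where \<delta>: "0 < \<delta>" "\<delta> \<le> \<epsilon>" "singular_curve W C 0 \<delta> \<gamma>"
    using image_singular_curve[OF image frontal_onD(2)[OF assms(1)] ad(1)[unfolded assms(7)] assms(5)] by blast
  have "pure_frontal_point W C e (\<gamma> t)" if t: "t \<in> {-\<delta><..<\<delta>}" for t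
  proof -
    have "\<gamma> t \<in> sing_set W C" using \<delta>(3) t unfolding singular_curve_def by blast
    then show ?thesis using image_pure_frontal_point[OF image] sing by simp
  qed
  moreover have "\<bar>gauss_curvature C e p\<bar> \<le> B \<and> \<bar>mean_curvature C e p\<bar> \<le> B" if p: "p \<in> W - sing_set W C" for p
  proof -
    have "p \<in> W" "\<Psi> p \<in> ball 0 s" "\<Psi> p $ 2 \<noteq> 0" using p sing W(4)[of p] by auto
    then show ?thesis using B image_curvatures[OF image] by simp
  qed
  ultimately show ?thesis
    using W(1-3) image_frontal[OF image] \<delta> by blast
qed

end
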